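(* Suppose $2\mu\bar c\le\sigma^2 r$. Then $V(x,c)=\frac{\bar c}{r}(1-e^{-\gamma x})$ for all $(x,c)\in[0,\infty)\times[0,\bar c]$, and the constant strategy $C^*_t\equiv\bar c$ is optimal for every initial $(x,c)$.
   Context: Fix a filtered probability space $(\Omega,\mathcal F,(\mathcal F_t)_{t\ge0},\mathbb P)$ carrying a standard one-dimensional Brownian motion $W$, with $(\mathcal F_t)$ the augmented natural filtration of $W$. Constants: $\mu\in\mathbb R$, $\sigma>0$, $r>0$, $\bar c\in(0,\mu]$, $b\in[0,1]$. For an adapted dividend-rate process $C$ and $x\ge0$, the surplus is $X_t=x+\int_0^t(\mu-C_s)ds+\sigma W_t$ and the ruin time is $\tau=\inf\{t\ge0:X_t\le0\}$ ($\inf\emptyset=+\infty$). Given $c\in[0,\bar c]$, the running maximum is $M_t=\max\{c,\sup_{0\le s\le t}C_s\}$. $\Pi_{[c,\bar c]}$ denotes the set of adapted càdlàg processes $C$ with $bM_t\le C_t\le\bar c$ for $0\le t\le\tau$, and $V(x,c)=\sup_{C\in\Pi_{[c,\bar c]}}\mathbb E[\int_0^\tau e^{-rt}C_t\,dt]$. $\gamma=\frac{\sqrt{(\mu-\bar c)^2+2\sigma^2 r}+(\mu-\bar c)}{\sigma^2}$. *)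

theory Defs
  imports "HOL-Probability.Probability"
begin

definition is_std_BM :: "'a measure \<Rightarrow> (real \<Rightarrow> 'a \<Rightarrow> real) \<Rightarrow> bool" where
  "is_std_BM M W \<longleftrightarrow>
     prob_space M \<and>
     (\<forall>t\<ge>0. W t \<in> borel_measurable M) \<and>
     (\<forall>\<omega>\<in>space M. W 0 \<omega> = 0 \<and> continuous_on {0..} (\<lambda>t. W t \<omega>)) \<and>
     (\<forall>s t. 0 \<le> s \<and> s < t \<longrightarrow>
        distributed M lborel (\<lambda>\<omega>. W t \<omega> - W s \<omega>)
          (\<lambda>y. ennreal (normal_density 0 (sqrt (t - s)) y))) \<and>
     (\<forall>(n::nat) (ts::nat \<Rightarrow> real). 0 \<le> ts 0 \<and> (\<forall>i<n. ts i < ts (Suc i)) \<longrightarrow>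
        prob_space.indep_vars M (\<lambda>_. borel) (\<lambda>i \<omega>. W (ts (Suc i)) \<omega> - W (ts i) \<omega>) {..<n})"

definition natural_sets :: "'a measure \<Rightarrow> (real \<Rightarrow> 'a \<Rightarrow> real) \<Rightarrow> real \<Rightarrow> 'a set set" where
  "natural_sets M W t =
     sigma_sets (space M) (\<Union>s\<in>{0..t}. {W s -` A \<inter> space M | A. A \<in> sets borel})"

definition aug_filtration :: "'a measure \<Rightarrow> (real \<Rightarrow> 'a \<Rightarrow> real) \<Rightarrow> real \<Rightarrow> 'a measure" where
  "aug_filtration M W t = sigma (space M) (natural_sets M W t \<union> null_sets M)"

definition cadlag :: "(real \<Rightarrow> real) \<Rightarrow> bool" where
  "cadlag f \<longleftrightarrow> (\<forall>t\<ge>0. continuous (at_right t) f) \<and>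
                  (\<forall>t>0. \<exists>l. (f \<longlongrightarrow> l) (at_left t))"

definition surplus ::
  "real \<Rightarrow> real \<Rightarrow> real \<Rightarrow> (real \<Rightarrow> 'a \<Rightarrow> real) \<Rightarrow> (real \<Rightarrow> 'a \<Rightarrow> real) \<Rightarrow> real \<Rightarrow> 'a \<Rightarrow> real" where
  "surplus x \<mu> \<sigma> W C t \<omega> = x + (LBINT s:{0..t}. \<mu> - C s \<omega>) + \<sigma> * W t \<omega>"

text \<open>Ruin time \<tau> = inf{t \<ge> 0 : X_t \<le> 0}, with inf of the empty set = +\<infinity>.\<close>
definition ruin_time :: "(real \<Rightarrow> 'a \<Rightarrow> real) \<Rightarrow> 'a \<Rightarrow> ereal" where
  "ruin_time X \<omega> = Inf (ereal ` {t. 0 \<le> t \<and> X t \<omega> \<le> 0})"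

definition running_max :: "real \<Rightarrow> (real \<Rightarrow> 'a \<Rightarrow> real) \<Rightarrow> real \<Rightarrow> 'a \<Rightarrow> real" where
  "running_max c C t \<omega> = max c (Sup ((\<lambda>s. C s \<omega>) ` {0..t}))"

definition admissible ::
  "'a measure \<Rightarrow> (real \<Rightarrow> 'a \<Rightarrow> real) \<Rightarrow> real \<Rightarrow> real \<Rightarrow> real \<Rightarrow> real \<Rightarrow> real \<Rightarrow> real
    \<Rightarrow> (real \<Rightarrow> 'a \<Rightarrow> real) set" where
  "admissible M W \<mu> \<sigma> cbar b x c =
     {C. (\<forall>t\<ge>0. C t \<in> borel_measurable (aug_filtration M W t)) \<and>
         (\<forall>\<omega>\<in>space M. cadlag (\<lambda>t. C t \<omega>)) \<and>
         (\<forall>\<omega>\<in>space M. \<forall>t\<ge>0. ereal t \<le> ruin_time (surplus x \<mu> \<sigma> W C) \<omega> \<longrightarrow>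
             b * running_max c C t \<omega> \<le> C t \<omega> \<and> C t \<omega> \<le> cbar)}"

text \<open>Expected discounted dividends E[\<integral>_0^\<tau> e^{-rt} C_t dt] (nonnegative for admissible C).\<close>
definition payoff ::
  "'a measure \<Rightarrow> (real \<Rightarrow> 'a \<Rightarrow> real) \<Rightarrow> real \<Rightarrow> real \<Rightarrow> real \<Rightarrow> real \<Rightarrow> (real \<Rightarrow> 'a \<Rightarrow> real) \<Rightarrow> ennreal" where
  "payoff M W \<mu> \<sigma> r x C =
     (\<integral>\<^sup>+\<omega>. (\<integral>\<^sup>+t\<in>{t. 0 \<le> t \<and> ereal t < ruin_time (surplus x \<mu> \<sigma> W C) \<omega>}.
                 ennreal (exp (- r * t) * C t \<omega>) \<partial>lborel) \<partial>M)"

definition value_fun ::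
  "'a measure \<Rightarrow> (real \<Rightarrow> 'a \<Rightarrow> real) \<Rightarrow> real \<Rightarrow> real \<Rightarrow> real \<Rightarrow> real \<Rightarrow> real \<Rightarrow> real \<Rightarrow> real \<Rightarrow> ennreal" where
  "value_fun M W \<mu> \<sigma> r cbar b x c =
     (SUP C\<in>admissible M W \<mu> \<sigma> cbar b x c. payoff M W \<mu> \<sigma> r x C)"

end

theory Submission
  imports Defs
begin

text \<open>
  Let \<open>v(x) = cbar/r (1 - exp(-\<gamma> x))\<close>. The choice of \<open>\<gamma>\<close> gives
  \<open>exp(-r t - \<gamma> X\<^sub>t) = exp(-\<gamma> x) Z\<^sub>t exp(-\<gamma> B\<^sub>t)\<close> up to ruin, where \<open>Z\<close> is the exponential
  martingale of \<open>-\<gamma> \<sigma> W\<close> and \<open>B\<^sub>t\<close> is the integral of \<open>cbar - C\<close>. Since \<open>B\<close> has finite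
  variation, no stochastic integral is needed: the pathwise bound
  \<open>1 \<le> exp(-\<gamma> B\<^sub>T) + \<gamma> \<integral> exp(-\<gamma> B) dB\<close> is integrated against \<open>Z\<^sub>T\<close>, the integral term is
  reduced to \<open>Z\<^sub>s\<close> by Fubini and the martingale property, and the first term to the value
  \<open>Z\<^sub>\<rho>\<close> at \<open>\<rho> = min \<tau> T\<close> by optional stopping. This yields
  \<open>exp(-\<gamma> x) \<le> E exp(-r \<rho>) + \<gamma> E \<integral> exp(-r s) dB\<^sub>s\<close>. The hypothesis on the constants
  is exactly \<open>\<gamma> cbar \<le> r\<close>, i.e. \<open>v' \<le> 1\<close>, and then the payoff is at most \<open>v(x)\<close> as
  \<open>T\<close> tends to infinity. For \<open>C = cbar\<close> one has \<open>B = 0\<close>, so \<open>E exp(-r \<tau>) = exp(-\<gamma> x)\<close>.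
\<close>

section \<open>Right-continuous paths and processes\<close>

text \<open>\<open>\<gamma>\<close> is the positive root of
  \<open>q(g) = \<sigma>^2 g^2 / 2 - g (\<mu> - cbar) - r\<close>: under \<open>C = cbar\<close> the
  surplus has drift \<open>\<mu> - cbar\<close>, and \<open>q(\<gamma>) = 0\<close> makes
  \<open>exp(-r t - \<gamma> X)\<close> a martingale. Since \<open>q(0) < 0\<close>, the bound
  \<open>\<gamma> \<le> r / cbar\<close> means \<open>q(r / cbar) \<ge> 0\<close>, and this value is
  \<open>r (\<sigma>^2 r - 2 \<mu> cbar) / (2 cbar^2)\<close>. Dividends enter through an accounting
  identity: a perpetuity at rate \<open>cbar\<close>, worth \<open>cbar / r\<close>, splits into
  what is paid before \<open>\<rho>\<close>, what is withheld, and the perpetuity from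
  \<open>\<rho>\<close> on. A withheld unit lowers the last term by at most
  \<open>\<gamma> cbar / r \<le> 1\<close>, so withholding cannot pay off. Two features of the
  setting shape the work. Brownian motion is given by increments at finitely many times, so the
  martingale property for the augmented filtration has to be derived. Admissibility binds
  \<open>C\<close> only until ruin, so all rates are killed there. The finite horizon keeps the
  second moments of \<open>Z\<close> finite, and discounting makes its cost
  \<open>O(exp(-r T))\<close>. With nonnegative extended integrals, finiteness matters only where a
  term is cancelled or a limit is taken.\<close>

lemma tendsto_at_right_seq:
  fixes f :: "real \<Rightarrow> real"
  assumes f: "continuous (at_right s) f" and u: "u \<longlonglongrightarrow> s" "\<And>n. s \<le> u n"
  shows "(\<lambda>n. f (u n)) \<longlonglongrightarrow> f s"
proof -
  \<comment> \<open>\<open>at s within A\<close> ignores \<open>s\<close> itself, so both filters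
    agree. The closed half-line is the form that admits sequences touching \<open>s\<close>.\<close>
  have "at s within {s..} = at_right s"
    by (rule arg_cong[where f="\<lambda>A. inf (nhds s) (principal A)", of "{s..} - {s}" "{s<..} - {s}", folded at_within_def]) auto
  then have "continuous (at s within {s..}) f"
    using f by (simp add: continuous_within)
  then show ?thesis
    using u by (auto simp: continuous_within_sequentially o_def)
qed

text \<open>Bisection: boundedness passes to adjacent intervals, and near each point it follows from
  the value and the one-sided limits.\<close>

lemma cadlag_bounded:
  assumes f: "cadlag f" and T: "0 \<le> T"
  obtains K where "\<And>s. s \<in> {0..T} \<Longrightarrow> \<bar>f s\<bar> \<le> K"
proof -
  \<comment> \<open>The bisection principle tests all small intervals around a point, including ones
    that reach into negative times, where \<open>cadlag\<close> says nothing; hence the intersection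
    with \<open>{0..}\<close>.\<close>
  define P where "P a b \<longleftrightarrow> (\<exists>K. \<forall>s\<in>{a..b} \<inter> {0..}. \<bar>f s\<bar> \<le> K)" for a b
  have "P 0 T"
    using T
  proof (induction rule: Bolzano)
    case (trans a b c)
    then obtain K L where "\<forall>s\<in>{a..b} \<inter> {0..}. \<bar>f s\<bar> \<le> K" "\<forall>s\<in>{b..c} \<inter> {0..}. \<bar>f s\<bar> \<le> L"
      unfolding P_def by blast
    then have "\<bar>f s\<bar> \<le> max K L" if "s \<in> {a..c} \<inter> {0..}" for s
      using that by (cases "s \<le> b") (auto simp: le_max_iff_disj)
    then show ?case
      unfolding P_def by blast
  next
    case (local x)
    have "((\<lambda>s. \<bar>f s\<bar>) \<longlongrightarrow> \<bar>f x\<bar>) (at_right x)"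
      using f local by (intro tendsto_rabs) (auto simp: cadlag_def continuous_within)
    then have "eventually (\<lambda>s. \<bar>f s\<bar> < \<bar>f x\<bar> + 1) (at_right x)"
      by (rule order_tendstoD) simp
    then obtain e where e: "e > x" "\<And>s. x < s \<Longrightarrow> s < e \<Longrightarrow> \<bar>f s\<bar> < \<bar>f x\<bar> + 1"
      by (auto simp: eventually_at_right[of x "x + 1"])
    \<comment> \<open>Left limits exist only at positive times. At 0 any \<open>l\<close> serves, as
      no time in \<open>{0..}\<close> lies to the left.\<close>
    obtain l d where d: "d < x" "\<And>s. d < s \<Longrightarrow> s < x \<Longrightarrow> 0 \<le> s \<Longrightarrow> \<bar>f s\<bar> < \<bar>l\<bar> + 1"
    proof (cases "x = 0")
      case True
      then show ?thesis by (intro that[of "-1" 0]) auto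
    next
      case False
      with local have "0 < x" by simp
      with f obtain l where "(f \<longlongrightarrow> l) (at_left x)"
        unfolding cadlag_def by blast
      then have "((\<lambda>s. \<bar>f s\<bar>) \<longlongrightarrow> \<bar>l\<bar>) (at_left x)"
        by (rule tendsto_rabs)
      then have "eventually (\<lambda>s. \<bar>f s\<bar> < \<bar>l\<bar> + 1) (at_left x)"
        by (rule order_tendstoD) simp
      then obtain d where "d < x" "\<And>s. d < s \<Longrightarrow> s < x \<Longrightarrow> \<bar>f s\<bar> < \<bar>l\<bar> + 1"
        by (auto simp: eventually_at_left[of "x - 1" x])
      then show ?thesis by (intro that[of d l]) auto
    qed
    have "\<bar>f s\<bar> \<le> max (\<bar>f x\<bar> + 1) (\<bar>l\<bar> + 1)"
      if "d < s" "s < e" "0 \<le> s" for s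
      using e(2)[of s] d(2)[of s] that by (cases s x rule: linorder_cases) auto
    then show ?case
      using e(1) d(1) unfolding P_def
      by (intro exI[of _ "min (x - d) (e - x)"])
        (auto intro!: exI[of _ "max (\<bar>f x\<bar> + 1) (\<bar>l\<bar> + 1)"])
  qed
  then obtain K where "\<forall>s\<in>{0..T} \<inter> {0..}. \<bar>f s\<bar> \<le> K"
    unfolding P_def by blast
  then show ?thesis by (intro that[of K]) simp
qed

text \<open>Each path is sampled at the next grid point to the right, so right continuity gives a
  pointwise limit of functions that use countably many times. With the sigma-algebra at time
  \<open>T\<close> in place of \<open>F\<close> this is progressive measurability.\<close>

lemma borel_measurable_pair_right_continuous:
  fixes f :: "real \<Rightarrow> 'a \<Rightarrow> real"
  assumes meas: "\<And>s. 0 \<le> s \<Longrightarrow> s \<le> T \<Longrightarrow> f s \<in> borel_measurable F"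
    and cont: "\<And>\<omega> s. \<omega> \<in> space F \<Longrightarrow> 0 \<le> s \<Longrightarrow> continuous (at_right s) (\<lambda>s. f s \<omega>)"
    and T: "0 \<le> T"
  shows "(\<lambda>(\<omega>, s). indicator {0..T} s * f s \<omega>) \<in> borel_measurable (F \<Otimes>\<^sub>M lborel)"
proof -
  \<comment> \<open>Clamping keeps every sampled time in \<open>{0..T}\<close>, where measurability
    is assumed; the ceiling in \<open>c\<close> makes the samples approach \<open>s\<close> from the
    right.\<close>
  define u where "u n k = max 0 (min T (real_of_int k / real (Suc n)))" for n k
  define c where "c n s = \<lceil>real (Suc n) * s\<rceil>" for n and s :: real
  have u_lim: "(\<lambda>n. u n (c n s)) \<longlonglongrightarrow> s" "\<And>n. s \<le> u n (c n s)" if s: "0 \<le> s" "s \<le> T" for s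
  proof -
    have ge: "s \<le> real_of_int (c n s) / real (Suc n)" for n
      unfolding c_def by (simp add: field_simps del: of_nat_Suc)
    show le: "s \<le> u n (c n s)" for n
      unfolding u_def using ge[of n] s by (intro max.coboundedI2 min.boundedI)
    have "real_of_int (c n s) \<le> real (Suc n) * s + 1" for n
      unfolding c_def by linarith
    then have le_n: "real_of_int (c n s) / real (Suc n) \<le> s + 1 / real (Suc n)" for n
      by (simp add: field_simps del: of_nat_Suc)
    have "u n (c n s) \<le> s + 1 / real (Suc n)" for n
      using s le_n[of n] order_trans[OF s(1), of "s + 1 / real (Suc n)"]
      unfolding u_def by (intro max.boundedI min.coboundedI2) (simp_all del: of_nat_Suc)
    moreover have "(\<lambda>n. s + 1 / real (Suc n)) \<longlonglongrightarrow> s + 0"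
      using LIMSEQ_inverse_real_of_nat by (intro tendsto_intros) (simp add: inverse_eq_divide)
    ultimately show "(\<lambda>n. u n (c n s)) \<longlonglongrightarrow> s"
      using le by (intro tendsto_sandwich[of "\<lambda>_. s" "\<lambda>n. u n (c n s)" sequentially "\<lambda>n. s + 1 / real (Suc n)"] always_eventually allI)
        (simp_all only: tendsto_const add_0_right)
  qed
  show ?thesis
  proof (rule borel_measurable_LIMSEQ_real)
    show "(\<lambda>z. indicator {0..T} (snd z) * f (u n (c n (snd z))) (fst z)) \<in> borel_measurable (F \<Otimes>\<^sub>M lborel)" for n
    proof (intro borel_measurable_times)
      show "(\<lambda>z. f (u n (c n (snd z))) (fst z)) \<in> borel_measurable (F \<Otimes>\<^sub>M lborel)"
      proof (rule measurable_compose_countable[where g="\<lambda>z. c n (snd z)"])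
        fix k :: int
        have [measurable]: "f (u n k) \<in> borel_measurable F"
          using T by (intro meas) (auto simp: u_def)
        show "(\<lambda>z. f (u n k) (fst z)) \<in> borel_measurable (F \<Otimes>\<^sub>M lborel)"
          by measurable
      qed (simp add: c_def)
    qed measurable
    fix z assume z: "z \<in> space (F \<Otimes>\<^sub>M (lborel :: real measure))"
    obtain \<omega> s where [simp]: "z = (\<omega>, s)" by fastforce
    show "(\<lambda>n. indicator {0..T} (snd z) * f (u n (c n (snd z))) (fst z))
        \<longlonglongrightarrow> (case z of (\<omega>, s) \<Rightarrow> indicator {0..T} s * f s \<omega>)"
    proof (cases "s \<in> {0..T}")
      case True
      then have s: "0 \<le> s" "s \<le> T" by auto
      have "(\<lambda>n. f (u n (c n s)) \<omega>) \<longlonglongrightarrow> f s \<omega>"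
        using z s(1) by (intro tendsto_at_right_seq[OF cont u_lim[OF s]]) (simp_all add: space_pair_measure)
      then show ?thesis
        using True by simp
    qed simp
  qed
qed

text \<open>A continuous positive path has a positive minimum on a compact interval, so the
  uncountable condition becomes: for some \<open>n\<close>, at least \<open>1 / Suc n\<close> on a
  countable dense set. Mere positivity on the dense set would not suffice.\<close>

lemma sets_all_pos_continuous:
  fixes X :: "real \<Rightarrow> 'a \<Rightarrow> real"
  assumes meas: "\<And>s. 0 \<le> s \<Longrightarrow> s \<le> t \<Longrightarrow> X s \<in> borel_measurable F"
    and cont: "\<And>\<omega>. \<omega> \<in> space F \<Longrightarrow> continuous_on {0..t} (\<lambda>s. X s \<omega>)"
    and t: "0 \<le> t"
  shows "{\<omega>\<in>space F. \<forall>s\<in>{0..t}. 0 < X s \<omega>} \<in> sets F"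
proof -
  obtain Q where Q: "countable Q" "Q \<subseteq> {0..t}" "{0..t} \<subseteq> closure Q"
    using separable by metis
  have cQ: "closure Q = {0..t}"
    using Q by (simp add: closure_minimal subset_antisym)
  have "{\<omega>\<in>space F. \<forall>s\<in>{0..t}. 0 < X s \<omega>} = {\<omega>\<in>space F. \<exists>n. \<forall>q\<in>Q. 1 / real (Suc n) \<le> X q \<omega>}"
  proof safe
    fix \<omega> assume \<omega>: "\<omega> \<in> space F" and pos: "\<forall>s\<in>{0..t}. 0 < X s \<omega>"
    obtain s where s: "s \<in> {0..t}" "\<And>q. q \<in> {0..t} \<Longrightarrow> X s \<omega> \<le> X q \<omega>"
      using continuous_attains_inf[OF _ _ cont[OF \<omega>]] t by auto
    from s(1) pos have "0 < X s \<omega>"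
      by blast
    then obtain n where "1 / real (Suc n) < X s \<omega>"
      by (rule nat_approx_posE)
    then show "\<exists>n. \<forall>q\<in>Q. 1 / real (Suc n) \<le> X q \<omega>"
      using s Q(2) by (intro exI[of _ n] ballI) (meson less_imp_le order_trans subsetD)
  next
    fix \<omega> n s assume \<omega>: "\<omega> \<in> space F" and n: "\<forall>q\<in>Q. 1 / real (Suc n) \<le> X q \<omega>" and s: "s \<in> {0..t}"
    have "1 / real (Suc n) \<le> X s \<omega>"
      using continuous_ge_on_closure[of Q "\<lambda>s. X s \<omega>" s] cont[OF \<omega>] n s cQ by metis
    then show "0 < X s \<omega>"
      using less_le_trans[of 0 "1 / real (Suc n)" "X s \<omega>"] by simp
  qed
  also have "\<dots> \<in> sets F"
  proof -
    have [measurable]: "{\<omega>\<in>space F. 1 / (1 + real n) \<le> X q \<omega>} \<in> sets F" if "q \<in> Q" for n q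
      using meas[of q] that Q by (intro borel_measurable_le) auto
    show ?thesis
      using Q(1) by (intro sets.sets_Collect_countable_Ex sets.sets_Collect_countable_All') simp_all
  qed
  finally show ?thesis .
qed

section \<open>Time integrals of a path\<close>

lemma continuous_on_indefinite_set_integral:
  fixes f :: "real \<Rightarrow> real"
  assumes f: "\<And>T. 0 \<le> T \<Longrightarrow> set_integrable lborel {0..T} f"
  shows "continuous_on {0..} (\<lambda>t. LBINT s:{0..t}. f s)"
  unfolding continuous_on_eq_continuous_within
proof
  fix t :: real assume t: "t \<in> {0..}"
  have "continuous_on {0..t+1} (\<lambda>t. integral {0..t} f)"
    using f[of "t+1"] t by (intro indefinite_integral_continuous_1 set_borel_integral_eq_integral) auto
  then have "continuous_on {0..t+1} (\<lambda>t. LBINT s:{0..t}. f s)"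
    by (rule continuous_on_eq) (simp add: set_borel_integral_eq_integral f)
  then have "continuous (at t within {0..t+1}) (\<lambda>t. LBINT s:{0..t}. f s)"
    using t by (simp add: continuous_on_eq_continuous_within)
  moreover have "at t within {0..t+1} = at t within {0..}"
    by (rule at_within_nhd[of t "{..<t+1}"]) auto
  ultimately show "continuous (at t within {0..}) (\<lambda>t. LBINT s:{0..t}. f s)"
    by simp
qed

lemma set_integrable_bounded_Icc:
  fixes f :: "real \<Rightarrow> real"
  assumes "set_borel_measurable borel {a..b} f" and "\<And>s. s \<in> {a..b} \<Longrightarrow> \<bar>f s\<bar> \<le> K"
  shows "set_integrable lborel {a..b} f"
  unfolding set_integrable_def
proof (rule Bochner_Integration.integrable_bound)
  show "integrable lborel (\<lambda>s. indicator {a..b} s * K)"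
    by (intro integrable_mult_left integrable_real_indicator) (simp_all add: emeasure_lborel_Icc_eq)
  show "(\<lambda>s. indicator {a..b} s *\<^sub>R f s) \<in> borel_measurable lborel"
    using assms(1) by (simp add: set_borel_measurable_def)
  show "AE s in lborel. norm (indicator {a..b} s *\<^sub>R f s) \<le> norm (indicator {a..b} s * K)"
    using assms(2) by (intro AE_I2) (force simp: indicator_def)
qed

lemma set_borel_measurable_right_continuous:
  fixes f :: "real \<Rightarrow> real"
  assumes "\<And>s. 0 \<le> s \<Longrightarrow> continuous (at_right s) f" "0 \<le> T"
  shows "set_borel_measurable borel {0..T} f"
proof -
  \<comment> \<open>Joint measurability over a one-point space is measurability in time.\<close>
  have "(\<lambda>(\<omega>, s). indicator {0..T} s * f s) \<in> borel_measurable (count_space (UNIV::unit set) \<Otimes>\<^sub>M lborel)"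
    by (rule borel_measurable_pair_right_continuous) (use assms in auto)
  then have "(\<lambda>s. (case ((), s) of (\<omega>, s) \<Rightarrow> indicator {0..T} s * f s)) \<in> borel_measurable lborel"
    by (rule measurable_compose[rotated]) simp
  then show ?thesis
    by (simp add: set_borel_measurable_def)
qed

lemma cadlag_set_integrable:
  assumes "cadlag f" "0 \<le> T"
  shows "set_integrable lborel {0..T} f"
proof -
  obtain K where "\<And>s. s \<in> {0..T} \<Longrightarrow> \<bar>f s\<bar> \<le> K"
    using cadlag_bounded assms by blast
  then show ?thesis
    using assms by (intro set_integrable_bounded_Icc set_borel_measurable_right_continuous) (auto simp: cadlag_def)
qed

text \<open>\<open>D\<close> is merely measurable, so the fundamental theorem of calculus is replaced by a
  bisection argument: on short intervals the inequality holds up to a factor \<open>exp e\<close>.\<close>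

lemma one_minus_exp_le_integral:
  fixes D :: "real \<Rightarrow> real" and g :: real
  defines "B \<equiv> (\<lambda>t. LBINT s:{0..t}. D s)"
  assumes T: "0 \<le> T" and g: "0 \<le> g"
    and meas: "set_borel_measurable borel {0..T} D"
    and bound: "\<And>s. 0 \<le> s \<Longrightarrow> s \<le> T \<Longrightarrow> 0 \<le> D s \<and> D s \<le> K"
  shows "1 - exp (- g * B T) \<le> g * (LBINT s:{0..T}. D s * exp (- g * B s))"
proof -
  define h where "h s = D s * exp (- g * B s)" for s
  have K: "0 \<le> K"
    using bound[of 0] T by auto
  have intD: "set_integrable lborel {0..T} D"
    using meas bound by (intro set_integrable_bounded_Icc[of _ _ _ K]) auto
  then have D_on: "D integrable_on {0..T}"
    by (rule set_borel_integral_eq_integral)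
  have B_eq: "B t = integral {0..t} D" if "t \<le> T" for t
    unfolding B_def using that
    by (intro set_borel_integral_eq_integral set_integrable_subset[OF intD]) auto
  have contB: "continuous_on {0..T} B"
    using indefinite_integral_continuous_1[OF D_on] by (rule continuous_on_eq) (simp add: B_eq)
  have D_on': "D integrable_on {a..b}" if "0 \<le> a" "b \<le> T" for a b
    using D_on by (rule integrable_on_subinterval) (use that in auto)
  have B_diff: "B b - B a = integral {a..b} D" if "0 \<le> a" "a \<le> b" "b \<le> T" for a b
    using Henstock_Kurzweil_Integration.integral_combine[of 0 a b D] that D_on'[of 0 b] by (simp add: B_eq)
  have B_mono: "B a \<le> B b" if "0 \<le> a" "a \<le> b" "b \<le> T" for a b
    using B_diff[OF that] Henstock_Kurzweil_Integration.integral_nonneg[OF D_on'[of a b]] bound that by auto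
  have B_lip: "B b - B a \<le> K * (b - a)" if "0 \<le> a" "a \<le> b" "b \<le> T" for a b
    using integral_le[OF D_on'[of a b] integrable_const_ivl[of K a b]] B_diff[OF that] bound that
    by (auto simp: mult.commute)
  have intgh: "set_integrable lborel {0..T} h"
  proof (rule set_integrable_bounded_Icc)
    have "set_borel_measurable borel {0..T} (\<lambda>s. exp (- g * B s))"
      unfolding set_borel_measurable_def
      by (intro borel_measurable_continuous_on_indicator continuous_intros contB) simp
    with meas have "(\<lambda>s. (indicator {0..T} s *\<^sub>R D s) * (indicator {0..T} s *\<^sub>R exp (- g * B s))) \<in> borel_measurable borel"
      unfolding set_borel_measurable_def by (rule borel_measurable_times)
    also have "(\<lambda>s. (indicator {0..T} s *\<^sub>R D s) * (indicator {0..T} s *\<^sub>R exp (- g * B s))) = (\<lambda>s. indicator {0..T} s *\<^sub>R h s)"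
      by (auto simp: h_def indicator_def fun_eq_iff)
    finally show "set_borel_measurable borel {0..T} h"
      by (simp add: set_borel_measurable_def)
    fix s assume s: "s \<in> {0..T}"
    have "B 0 = 0" using T by (simp add: B_eq)
    then have "0 \<le> g * B s" using B_mono[of 0 s] s g by simp
    then show "\<bar>h s\<bar> \<le> K"
      using bound[of s] s mult_mono[of "D s" K "exp (- g * B s)" 1] by (simp add: h_def abs_mult)
  qed
  then have h_on: "h integrable_on {0..T}"
    by (rule set_borel_integral_eq_integral)
  have h_on': "h integrable_on {a..b}" if "0 \<le> a" "b \<le> T" for a b
    using h_on by (rule integrable_on_subinterval) (use that in auto)
  have approx: "1 - exp (- g * B T) \<le> exp e * (g * integral {0..T} h)" if e: "0 < e" for e
  proof -
    \<comment> \<open>The guards confine the claim to \<open>{0..T}\<close>, since bisection also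
      offers intervals that stick out.\<close>
    define P where "P a b \<longleftrightarrow> (0 \<le> a \<longrightarrow> b \<le> T \<longrightarrow>
      exp (- g * B a) - exp (- g * B b) \<le> exp e * (g * integral {a..b} h))" for a b
    have "P 0 T"
      using T
    proof (induction rule: Bolzano)
      case (trans a b c)
      show ?case
        unfolding P_def
      proof (intro impI)
        assume ac: "0 \<le> a" "c \<le> T"
        have "integral {a..b} h + integral {b..c} h = integral {a..c} h"
          using trans ac by (intro Henstock_Kurzweil_Integration.integral_combine h_on') auto
        with trans[unfolded P_def] ac show "exp (- g * B a) - exp (- g * B c) \<le> exp e * (g * integral {a..c} h)"
          by (simp add: ring_distribs flip: \<open>integral {a..b} h + _ = _\<close>)
      qed
    next
      case (local x)
      have gK: "0 \<le> g * K" using g K by simp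
      show ?case
        unfolding P_def
      \<comment> \<open>\<open>B\<close> is Lipschitz with constant \<open>K\<close>, so on
        intervals of this length \<open>g * B\<close> grows by at most \<open>e\<close>; the
        \<open>+ 1\<close> covers \<open>g * K = 0\<close>.\<close>
      proof (intro exI[of _ "e / (g * K + 1)"] conjI allI impI)
        show "0 < e / (g * K + 1)" using e gK by simp
        fix a b assume ab: "a \<le> x \<and> x \<le> b \<and> b - a < e / (g * K + 1)" and "0 \<le> a" "b \<le> T"
        then have ab': "0 \<le> a" "a \<le> b" "b \<le> T" by auto
        have "(b - a) * (g * K + 1) \<le> e"
          using ab gK by (simp add: pos_less_divide_eq add_nonneg_pos less_imp_le)
        then have "g * (K * (b - a)) \<le> e"
          using ab' by (simp add: algebra_simps)
        then have ge: "g * (B b - B a) \<le> e"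
          using B_lip[OF ab'] mult_left_mono[OF _ g] order_trans by blast
        have "exp (- g * B a) - exp (- g * B b) = exp (- g * B a) * (1 - exp (- (g * (B b - B a))))"
          by (simp add: right_diff_distrib flip: exp_add)
        also have "\<dots> \<le> exp (- g * B a) * (g * (B b - B a))"
          using exp_ge_add_one_self[of "- (g * (B b - B a))"] by (intro mult_left_mono) auto
        also have "\<dots> = g * integral {a..b} (\<lambda>s. D s * exp (- g * B a))"
          by (simp add: B_diff[OF ab'])
        also have "\<dots> \<le> g * integral {a..b} (\<lambda>s. h s * exp e)"
        proof (intro mult_left_mono[OF _ g] integral_le integrable_on_mult_left D_on' h_on' ab')
          fix s assume s: "s \<in> {a..b}"
          have "g * (B s - B a) \<le> g * (B b - B a)"
            using B_mono[of s b] s ab' g by (intro mult_left_mono) auto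
          then have "exp (- g * B a) \<le> exp (- g * B s) * exp e"
            using ge by (simp add: algebra_simps flip: exp_add)
          then show "D s * exp (- g * B a) \<le> h s * exp e"
            using bound[of s] s ab' by (simp add: h_def mult.assoc mult_left_mono)
        qed
        finally show "exp (- g * B a) - exp (- g * B b) \<le> exp e * (g * integral {a..b} h)"
          by (simp add: mult_ac)
      qed
    qed
    then show ?thesis using T by (simp add: B_eq P_def)
  qed
  have "((\<lambda>e. exp e * (g * integral {0..T} h)) \<longlongrightarrow> exp 0 * (g * integral {0..T} h)) (at_right 0)"
    by (intro tendsto_intros)
  then have "1 - exp (- g * B T) \<le> exp 0 * (g * integral {0..T} h)"
    by (rule tendsto_lowerbound)
      (use approx in \<open>auto intro: eventually_mono[OF eventually_at_right_less]\<close>)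
  then show ?thesis
    using set_borel_integral_eq_integral(2)[OF intgh] by (simp add: h_def)
qed

lemma continuous_on_Ici_imp_at_right:
  fixes f :: "real \<Rightarrow> real"
  assumes "continuous_on {0..} f" "0 \<le> s"
  shows "continuous (at_right s) f"
proof -
  have "continuous (at s within {0..}) f"
    using assms by (simp add: continuous_on_eq_continuous_within)
  then show ?thesis
    by (rule continuous_within_subset) (use assms(2) in auto)
qed

text \<open>If \<open>f\<close> is not integrable, the left side is 0 by the default value of the
  Bochner integral.\<close>

lemma ennreal_integral_le_nn_integral:
  fixes f :: "'a \<Rightarrow> real"
  assumes "\<And>x. x \<in> space M \<Longrightarrow> 0 \<le> f x"
  shows "ennreal (integral\<^sup>L M f) \<le> (\<integral>\<^sup>+x. ennreal (f x) \<partial>M)"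
  using assms nn_integral_eq_integral[of M f] not_integrable_integral_eq[of M f]
  by (cases "integrable M f") (auto simp: AE_I2)

section \<open>Brownian motion and its exponential martingale\<close>

text \<open>The single-time events that generate \<open>natural_sets\<close> are not closed under
  intersection; events at finitely many times are, as uniqueness of measures requires. The choice
  \<open>S = {}\<close> yields the whole space.\<close>

definition cylinder_sets :: "'a measure \<Rightarrow> (real \<Rightarrow> 'a \<Rightarrow> real) \<Rightarrow> real \<Rightarrow> 'a set set" where
  "cylinder_sets M W t =
     {{\<omega>\<in>space M. \<forall>s\<in>S. W s \<omega> \<in> A s} | S A.
        finite S \<and> S \<subseteq> {0..t} \<and> (\<forall>s. A s \<in> sets borel)}"

lemma space_aug_filtration [simp]: "space (aug_filtration M W t) = space M"
  by (simp add: aug_filtration_def space_measure_of_conv)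

locale brownian_motion =
  fixes M :: "'a measure" and W :: "real \<Rightarrow> 'a \<Rightarrow> real"
  assumes BM: "is_std_BM M W"
begin

abbreviation F :: "real \<Rightarrow> 'a measure" where "F \<equiv> aug_filtration M W"

sublocale prob_space M
  using BM by (simp add: is_std_BM_def)

lemma W_measurable [measurable]: "0 \<le> t \<Longrightarrow> W t \<in> borel_measurable M"
  using BM by (simp add: is_std_BM_def)

lemma W_0: "\<omega> \<in> space M \<Longrightarrow> W 0 \<omega> = 0"
  using BM by (simp add: is_std_BM_def)

lemma W_continuous: "\<omega> \<in> space M \<Longrightarrow> continuous_on {0..} (\<lambda>t. W t \<omega>)"
  using BM by (simp add: is_std_BM_def)

lemma W_increment_distributed:
  "0 \<le> s \<Longrightarrow> s < t \<Longrightarrow> distributed M lborel (\<lambda>\<omega>. W t \<omega> - W s \<omega>)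
     (\<lambda>y. ennreal (normal_density 0 (sqrt (t - s)) y))"
  using BM by (simp add: is_std_BM_def)

lemma W_increments_indep:
  fixes ts :: "nat \<Rightarrow> real"
  assumes "0 \<le> ts 0" "\<And>i. i < n \<Longrightarrow> ts i < ts (Suc i)"
  shows "indep_vars (\<lambda>_. borel) (\<lambda>i \<omega>. W (ts (Suc i)) \<omega> - W (ts i) \<omega>) {..<n}"
  using BM assms by (simp add: is_std_BM_def)

section \<open>The augmented filtration and independence of the next increment\<close>

lemma natural_sets_subset: "natural_sets M W t \<subseteq> sets M"
  unfolding natural_sets_def
proof (rule sets.sigma_sets_subset, safe)
  fix s A assume "s \<in> {0..t}" and A: "A \<in> sets (borel :: real measure)"
  then have "W s \<in> borel_measurable M" by simp
  from measurable_sets[OF this A] show "W s -` A \<inter> space M \<in> sets M" .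
qed

lemma sets_F: "sets (F t) = sigma_sets (space M) (natural_sets M W t \<union> null_sets M)"
  unfolding aug_filtration_def
  using natural_sets_subset[of t] sets.sets_into_space by (intro sets_measure_of) (auto simp: null_sets_def)

lemma subalgebra_F: "subalgebra M (F t)"
  unfolding subalgebra_def sets_F
  using natural_sets_subset[of t] by (auto intro!: sets.sigma_sets_subset)

lemma measurable_F_imp: "f \<in> borel_measurable (F t) \<Longrightarrow> f \<in> borel_measurable M"
  using subalgebra_F by (rule measurable_from_subalg)

lemma sets_F_imp: "A \<in> sets (F t) \<Longrightarrow> A \<in> sets M"
  using subalgebra_F unfolding subalgebra_def by blast

lemma sets_F_mono: "s \<le> t \<Longrightarrow> sets (F s) \<subseteq> sets (F t)"
proof -
  assume st: "s \<le> t"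
  have "natural_sets M W s \<subseteq> natural_sets M W t"
    unfolding natural_sets_def using st by (intro sigma_sets_mono') force
  then show ?thesis
    unfolding sets_F by (intro sigma_sets_mono') auto
qed

lemma measurable_F_mono:
  assumes "f \<in> borel_measurable (F s)" "s \<le> t"
  shows "f \<in> borel_measurable (F t)"
  using sets_F_mono[OF assms(2)] assms(1) by (auto simp: measurable_def)

lemma W_adapted:
  assumes "0 \<le> s" "s \<le> t"
  shows "W s \<in> borel_measurable (F t)"
proof (rule measurableI)
  fix A :: "real set" assume "A \<in> sets borel"
  with assms have "W s -` A \<inter> space M \<in> natural_sets M W t"
    unfolding natural_sets_def by (intro sigma_sets.Basic UN_I[of s]) auto
  then show "W s -` A \<inter> space (F t) \<in> sets (F t)"
    unfolding sets_F by (auto intro: sigma_sets.Basic)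
qed simp

lemma cylinder_sets_subset: "cylinder_sets M W t \<subseteq> sets (F t)"
proof
  fix C assume "C \<in> cylinder_sets M W t"
  then obtain S A where C: "C = {\<omega>\<in>space M. \<forall>s\<in>S. W s \<omega> \<in> A s}"
    and S: "finite S" "S \<subseteq> {0..t}" and A: "\<And>s. A s \<in> sets borel"
    by (auto simp: cylinder_sets_def)
  have "{\<omega>\<in>space (F t). \<forall>s\<in>S. W s \<omega> \<in> A s} \<in> sets (F t)"
  proof (rule sets.sets_Collect_finite_All[OF _ S(1)])
    fix s assume "s \<in> S"
    with S have "W s \<in> borel_measurable (F t)"
      by (intro W_adapted) auto
    then show "{\<omega>\<in>space (F t). W s \<omega> \<in> A s} \<in> sets (F t)"
      using A by measurable
  qed
  then show "C \<in> sets (F t)" by (simp add: C)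
qed

lemma sets_F_cylinder: "sets (F t) = sigma_sets (space M) (cylinder_sets M W t \<union> null_sets M)"
proof
  have "W s -` A \<inter> space M \<in> cylinder_sets M W t" if "s \<in> {0..t}" "A \<in> sets borel" for s A
    unfolding cylinder_sets_def using that
    by (intro CollectI exI[of _ "{s}"] exI[of _ "\<lambda>_. A"]) auto
  then have "natural_sets M W t \<subseteq> sigma_sets (space M) (cylinder_sets M W t)"
    unfolding natural_sets_def by (intro sigma_sets_mono) (auto intro!: sigma_sets.Basic)
  also have "\<dots> \<subseteq> sigma_sets (space M) (cylinder_sets M W t \<union> null_sets M)"
    by (intro sigma_sets_mono') auto
  finally show "sets (F t) \<subseteq> sigma_sets (space M) (cylinder_sets M W t \<union> null_sets M)"
    unfolding sets_F by (intro sigma_sets_mono) (auto intro: sigma_sets.Basic)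
  have "null_sets M \<subseteq> sets (F t)"
    unfolding sets_F by (auto intro: sigma_sets.Basic)
  then show "sigma_sets (space M) (cylinder_sets M W t \<union> null_sets M) \<subseteq> sets (F t)"
    using cylinder_sets_subset[of t] sets.sigma_sets_subset[of "cylinder_sets M W t \<union> null_sets M" "F t"] by simp
qed

text \<open>Meeting a null set gives a null set again; two cylinders combine over
  \<open>S \<union> S'\<close>, with \<open>UNIV\<close> as the constraint of the one that does not
  mention a time.\<close>

lemma Int_stable_cylinder_null: "Int_stable (cylinder_sets M W t \<union> null_sets M)"
proof (rule Int_stableI)
  have meas: "C \<in> sets M" if "C \<in> cylinder_sets M W t \<union> null_sets M" for C
    using that cylinder_sets_subset[of t] sets_F_imp[of C t] by auto
  fix C D assume CD: "C \<in> cylinder_sets M W t \<union> null_sets M" "D \<in> cylinder_sets M W t \<union> null_sets M"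
  show "C \<inter> D \<in> cylinder_sets M W t \<union> null_sets M"
  proof (cases "C \<in> null_sets M \<or> D \<in> null_sets M")
    case True
    then show ?thesis
      using meas[OF CD(1)] meas[OF CD(2)] null_set_Int1[of C M D] null_set_Int1[of D M C] by (auto simp: Int_commute)
  next
    case False
    with CD obtain S A S' A' where C: "C = {\<omega>\<in>space M. \<forall>s\<in>S. W s \<omega> \<in> A s}"
      "finite S" "S \<subseteq> {0..t}" "\<And>s. A s \<in> sets borel"
      and D: "D = {\<omega>\<in>space M. \<forall>s\<in>S'. W s \<omega> \<in> A' s}"
      "finite S'" "S' \<subseteq> {0..t}" "\<And>s. A' s \<in> sets borel"
      by (auto simp: cylinder_sets_def)
    have "C \<inter> D \<in> cylinder_sets M W t"
      unfolding cylinder_sets_def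
      by (intro CollectI exI[of _ "S \<union> S'"]
          exI[of _ "\<lambda>s. (if s \<in> S then A s else UNIV) \<inter> (if s \<in> S' then A' s else UNIV)"])
        (use C D in auto)
    then show ?thesis by simp
  qed
qed

text \<open>Once 0 and \<open>s\<close> are added to the times of \<open>C\<close> and all are
  sorted, each value of \<open>W\<close> is a partial sum of increments because
  \<open>W 0 = 0\<close>. So \<open>v (W s) * indicator C\<close> is a function of the increments up
  to \<open>s\<close>, which are jointly independent of the next one.\<close>

lemma nn_integral_cylinder_increment:
  fixes u v :: "real \<Rightarrow> ennreal"
  assumes C: "C \<in> cylinder_sets M W s" and st: "0 \<le> s" "s < t"
    and [measurable]: "u \<in> borel_measurable borel" "v \<in> borel_measurable borel"
  shows "(\<integral>\<^sup>+\<omega>. v (W s \<omega>) * indicator C \<omega> * u (W t \<omega> - W s \<omega>) \<partial>M) =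
    (\<integral>\<^sup>+\<omega>. v (W s \<omega>) * indicator C \<omega> \<partial>M) * (\<integral>\<^sup>+\<omega>. u (W t \<omega> - W s \<omega>) \<partial>M)"
proof -
  obtain S A where C_def: "C = {\<omega>\<in>space M. \<forall>s\<in>S. W s \<omega> \<in> A s}"
    and S: "finite S" "S \<subseteq> {0..s}" and A[measurable]: "\<And>s. A s \<in> sets borel"
    using C by (auto simp: cylinder_sets_def)
  \<comment> \<open>The added times 0 and \<open>s\<close> carry no constraint unless they lie in
    \<open>S\<close>.\<close>
  define A' where "A' r = (if r \<in> S then A r else UNIV)" for r
  have [measurable]: "A' r \<in> sets borel" for r
    by (simp add: A'_def)
  obtain xs where xs: "sorted_wrt (<) xs" "set xs = insert 0 (insert s S)"
    using S(1) by (metis finite_insert sorted_list_of_set.finite_set_strict_sorted)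
  obtain m where m: "length xs = Suc m"
    using xs(2) by (cases xs) auto
  \<comment> \<open>It will turn out that \<open>ts 0 = 0\<close>, \<open>ts m = s\<close> and
    \<open>ts (Suc m) = t\<close>, so increment number \<open>m\<close> is the one after
    \<open>s\<close>. For \<open>s = 0\<close> one has \<open>m = 0\<close> and the past is
    empty.\<close>
  define ts where "ts i = (if i < Suc m then xs ! i else t)" for i
  have xs_in: "0 \<le> r" "r \<le> s" if "r \<in> set xs" for r
    using that xs(2) S(2) st by auto
  have ts_mono: "ts i < ts (Suc i)" if "i < Suc m" for i
    using that xs(1) m xs_in[of "xs ! i"] st
    by (auto simp: ts_def sorted_wrt_iff_nth_less)
  have ts_in: "ts i \<in> set xs" if "i \<le> m" for i
    using that m by (simp add: ts_def)
  have mono: "ts i \<le> ts j" if "i \<le> j" "j \<le> m" for i j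
    using that xs(1) m by (cases "i = j") (auto simp: ts_def sorted_wrt_iff_nth_less less_imp_le)
  have ts_ex: "\<exists>i\<le>m. ts i = r" if "r \<in> set xs" for r
    using that m by (metis in_set_conv_nth less_Suc_eq_le ts_def)
  have ts_0: "ts 0 = 0"
    using ts_ex[of 0] xs(2) mono[of 0] xs_in(1)[OF ts_in[of 0]] by force
  have ts_m: "ts m = s"
    using ts_ex[of s] xs(2) mono[of _ m] xs_in(2)[OF ts_in[of m]] by force
  have ts_Suc: "ts (Suc m) = t" by (simp add: ts_def)
  define X where "X i \<omega> = W (ts (Suc i)) \<omega> - W (ts i) \<omega>" for i \<omega>
  have W_ts: "W (ts k) \<omega> = (\<Sum>i<k. X i \<omega>)" if "\<omega> \<in> space M" for k \<omega>
    using sum_lessThan_telescope[of "\<lambda>i. W (ts i) \<omega>" k] W_0[OF that] by (simp add: X_def ts_0)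
  have "indep_vars (\<lambda>_. borel) X {..<Suc m}"
    unfolding X_def using ts_mono by (intro W_increments_indep) (simp_all add: ts_0)
  then have indep: "indep_var (Pi\<^sub>M {..<m} (\<lambda>_. borel)) (\<lambda>\<omega>. \<lambda>i\<in>{..<m}. X i \<omega>)
      (Pi\<^sub>M {m} (\<lambda>_. borel)) (\<lambda>\<omega>. \<lambda>i\<in>{m}. X i \<omega>)"
    by (rule indep_var_restrict) auto
  define \<Phi> where "\<Phi> f = v (\<Sum>i<m. f i) * (\<Prod>k\<le>m. indicator (A' (ts k)) (\<Sum>i<k. f i))"
    for f :: "nat \<Rightarrow> real"
  define \<Psi> where "\<Psi> f = u (f m)" for f :: "nat \<Rightarrow> real"
  have "indep_var borel (\<Phi> \<circ> (\<lambda>\<omega>. \<lambda>i\<in>{..<m}. X i \<omega>)) borel (\<Psi> \<circ> (\<lambda>\<omega>. \<lambda>i\<in>{m}. X i \<omega>))"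
  proof (rule indep_var_compose[OF indep])
    have [measurable]: "(\<lambda>f. \<Sum>i<k. f i) \<in> borel_measurable (Pi\<^sub>M {..<m} (\<lambda>_. borel :: real measure))" if "k \<le> m" for k
      using that by (intro borel_measurable_sum measurable_component_singleton) auto
    have "(\<lambda>f. indicator (A' (ts k)) (\<Sum>i<k. f i) :: ennreal) \<in> borel_measurable (Pi\<^sub>M {..<m} (\<lambda>_. borel :: real measure))"
      if "k \<le> m" for k
      using that by measurable
    then show "\<Phi> \<in> borel_measurable (Pi\<^sub>M {..<m} (\<lambda>_. borel))"
      unfolding \<Phi>_def by (intro borel_measurable_times_ennreal borel_measurable_prod_ennreal) auto
    show "\<Psi> \<in> borel_measurable (Pi\<^sub>M {m} (\<lambda>_. borel))"
      unfolding \<Psi>_def by measurable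
  qed
  moreover have "case_bool borel borel = (\<lambda>_. borel :: ennreal measure)"
    by (simp add: fun_eq_iff split: bool.split)
  ultimately have "indep_vars (\<lambda>_. borel) (case_bool (\<Phi> \<circ> (\<lambda>\<omega>. \<lambda>i\<in>{..<m}. X i \<omega>)) (\<Psi> \<circ> (\<lambda>\<omega>. \<lambda>i\<in>{m}. X i \<omega>))) UNIV"
    by (simp add: indep_var_def)
  from indep_vars_nn_integral[OF _ this]
  have prod: "(\<integral>\<^sup>+\<omega>. \<Phi> (\<lambda>i\<in>{..<m}. X i \<omega>) * \<Psi> (\<lambda>i\<in>{m}. X i \<omega>) \<partial>M) =
      (\<integral>\<^sup>+\<omega>. \<Phi> (\<lambda>i\<in>{..<m}. X i \<omega>) \<partial>M) * (\<integral>\<^sup>+\<omega>. \<Psi> (\<lambda>i\<in>{m}. X i \<omega>) \<partial>M)"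
    by (simp add: UNIV_bool comp_def mult.commute)
  have \<Phi>_eq: "\<Phi> (\<lambda>i\<in>{..<m}. X i \<omega>) = v (W s \<omega>) * indicator C \<omega>" if \<omega>: "\<omega> \<in> space M" for \<omega>
  proof -
    have sum_eq: "(\<Sum>i<k. (\<lambda>i\<in>{..<m}. X i \<omega>) i) = W (ts k) \<omega>" if "k \<le> m" for k
      unfolding W_ts[OF \<omega>] using that by (intro sum.cong) auto
    have "(\<Prod>k\<le>m. indicator (A' (ts k)) (W (ts k) \<omega>)) = (indicator C \<omega> :: ennreal)"
    proof (cases "\<omega> \<in> C")
      case True
      then show ?thesis by (simp add: C_def A'_def)
    next
      case False
      with \<omega> obtain r where r: "r \<in> S" "W r \<omega> \<notin> A r" by (auto simp: C_def)
      with ts_ex[of r] xs(2) obtain k where "k \<le> m" "ts k = r" by auto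
      with r False show ?thesis
        by (intro trans[OF prod_zero]) (auto simp: A'_def intro!: bexI[of _ k])
    qed
    then show ?thesis
      using sum_eq ts_m by (simp add: \<Phi>_def)
  qed
  have \<Psi>_eq: "\<Psi> (\<lambda>i\<in>{m}. X i \<omega>) = u (W t \<omega> - W s \<omega>)" for \<omega>
    by (simp add: \<Psi>_def X_def ts_m ts_Suc)
  show ?thesis
    using prod by (simp add: \<Phi>_eq \<Psi>_eq cong: nn_integral_cong)
qed

section \<open>The exponential martingale: moments, martingale property, optional stopping\<close>

definition exp_mart :: "real \<Rightarrow> real \<Rightarrow> 'a \<Rightarrow> real" where
  "exp_mart \<theta> t \<omega> = exp (- \<theta> * W t \<omega> - \<theta>\<^sup>2 * t / 2)"

lemma exp_mart_pos: "0 < exp_mart \<theta> t \<omega>"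
  by (simp add: exp_mart_def)

lemma exp_mart_adapted: "0 \<le> s \<Longrightarrow> s \<le> t \<Longrightarrow> exp_mart \<theta> s \<in> borel_measurable (F t)"
  using W_adapted[of s t] unfolding exp_mart_def by measurable

lemma exp_mart_measurable [measurable]: "0 \<le> t \<Longrightarrow> exp_mart \<theta> t \<in> borel_measurable M"
  unfolding exp_mart_def by measurable

lemma exp_mart_continuous: "\<omega> \<in> space M \<Longrightarrow> continuous_on {0..} (\<lambda>t. exp_mart \<theta> t \<omega>)"
  unfolding exp_mart_def by (intro continuous_intros W_continuous) simp_all

text \<open>Completing the square: the exponential factor shifts the normal density to mean
  \<open>-\<theta> (t - s)\<close> with the same variance, and a density has mass 1.\<close>

lemma nn_integral_exp_increment:
  assumes st: "0 \<le> s" "s < t"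
  shows "(\<integral>\<^sup>+\<omega>. ennreal (exp (- \<theta> * (W t \<omega> - W s \<omega>) - \<theta>\<^sup>2 * (t - s) / 2)) \<partial>M) = 1"
proof -
  have sq: "(sqrt (t - s))\<^sup>2 = t - s" using st by simp
  have "(\<integral>\<^sup>+\<omega>. ennreal (exp (- \<theta> * (W t \<omega> - W s \<omega>) - \<theta>\<^sup>2 * (t - s) / 2)) \<partial>M) =
      (\<integral>\<^sup>+y. ennreal (normal_density 0 (sqrt (t - s)) y) * ennreal (exp (- \<theta> * y - \<theta>\<^sup>2 * (t - s) / 2)) \<partial>lborel)"
    by (rule distributed_nn_integral[OF W_increment_distributed[OF st], symmetric]) measurable
  also have "\<dots> = (\<integral>\<^sup>+y. ennreal (normal_density (- \<theta> * (t - s)) (sqrt (t - s)) y) \<partial>lborel)"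
  proof (intro nn_integral_cong)
    fix y
    have "- y\<^sup>2 / (2 * (t - s)) + (- \<theta> * y - \<theta>\<^sup>2 * (t - s) / 2) = - (y + \<theta> * (t - s))\<^sup>2 / (2 * (t - s))"
      using st by (simp add: field_simps power2_eq_square)
    then have "exp (- y\<^sup>2 / (2 * (t - s))) * exp (- \<theta> * y - \<theta>\<^sup>2 * (t - s) / 2) = exp (- (y + \<theta> * (t - s))\<^sup>2 / (2 * (t - s)))"
      by (simp only: exp_add[symmetric])
    then have "normal_density 0 (sqrt (t - s)) y * exp (- \<theta> * y - \<theta>\<^sup>2 * (t - s) / 2) =
        normal_density (- \<theta> * (t - s)) (sqrt (t - s)) y"
      by (simp only: normal_density_def sq mult.assoc diff_zero) (simp only: mult_minus_left diff_minus_eq_add)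
    then show "ennreal (normal_density 0 (sqrt (t - s)) y) * ennreal (exp (- \<theta> * y - \<theta>\<^sup>2 * (t - s) / 2)) =
        ennreal (normal_density (- \<theta> * (t - s)) (sqrt (t - s)) y)"
      by (simp only: ennreal_mult[symmetric] normal_density_nonneg exp_ge_zero)
  qed
  also have "\<dots> = 1"
    using prob_space.emeasure_space_1[OF prob_space_normal_density[of "sqrt (t - s)" "- \<theta> * (t - s)"]] st
    by (simp add: emeasure_density)
  finally show ?thesis .
qed

lemma nn_integral_exp_mart: "0 \<le> t \<Longrightarrow> (\<integral>\<^sup>+\<omega>. ennreal (exp_mart \<theta> t \<omega>) \<partial>M) = 1"
proof (cases "t = 0")
  case True
  then show ?thesis
    by (simp add: exp_mart_def W_0 emeasure_space_1 cong: nn_integral_cong)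
next
  case False
  assume "0 \<le> t"
  with False have t: "0 < t" by simp
  show ?thesis
    using nn_integral_exp_increment[of 0 t \<theta>] t by (simp add: exp_mart_def W_0 cong: nn_integral_cong)
qed

text \<open>The square is \<open>exp(\<theta>^2 t)\<close> times the exponential martingale with
  parameter \<open>2 \<theta>\<close>, whose mean is 1.\<close>

lemma nn_integral_exp_mart_sq:
  assumes "0 \<le> t"
  shows "(\<integral>\<^sup>+\<omega>. ennreal ((exp_mart \<theta> t \<omega>)\<^sup>2) \<partial>M) = ennreal (exp (\<theta>\<^sup>2 * t))"
proof -
  have "(exp_mart \<theta> t \<omega>)\<^sup>2 = exp (\<theta>\<^sup>2 * t) * exp_mart (2 * \<theta>) t \<omega>" for \<omega>
    by (simp add: exp_mart_def power2_eq_square exp_add[symmetric] algebra_simps)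
  then show ?thesis
    using assms nn_integral_exp_mart[of t "2 * \<theta>"] by (simp add: ennreal_mult nn_integral_cmult exp_mart_pos less_imp_le)
qed

text \<open>Together with the null sets the cylinders still form an intersection-stable generator,
  so the augmentation of the filtration causes no extra work.\<close>

lemma exp_mart_martingale:
  assumes st: "0 \<le> s" "s \<le> t" and H: "H \<in> borel_measurable (F s)"
  shows "(\<integral>\<^sup>+\<omega>. ennreal (exp_mart \<theta> t \<omega>) * H \<omega> \<partial>M) = (\<integral>\<^sup>+\<omega>. ennreal (exp_mart \<theta> s \<omega>) * H \<omega> \<partial>M)"
proof (cases "s = t")
  case False
  with st have st': "0 \<le> s" "s < t" by auto
  \<comment> \<open>The claim for all \<open>H\<close> says that the measures with densities
    \<open>exp_mart \<theta> s\<close> and \<open>exp_mart \<theta> t\<close> agree on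
    \<open>F s\<close>; as they are finite, agreement on the generator suffices.\<close>
  define D where "D r = density M (exp_mart \<theta> r)" for r
  have sub: "subalgebra (D r) (F s)" for r
    using subalgebra_F[of s] by (simp add: D_def subalgebra_def)
  have H_M: "H \<in> borel_measurable M"
    using H by (rule measurable_F_imp)
  have emD: "emeasure (D r) C = (\<integral>\<^sup>+\<omega>. ennreal (exp_mart \<theta> r \<omega>) * indicator C \<omega> \<partial>M)"
    if "0 \<le> r" "C \<in> sets M" for r C
    using that by (simp add: D_def emeasure_density)
  have "restr_to_subalg (D t) (F s) = restr_to_subalg (D s) (F s)"
  proof (rule measure_eqI_generator_eq[OF Int_stable_cylinder_null[of s], where \<Omega>="space M" and A="\<lambda>_. space M"])
    show "cylinder_sets M W s \<union> null_sets M \<subseteq> Pow (space M)"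
      by (auto simp: cylinder_sets_def null_sets_def dest: sets.sets_into_space)
    show "sets (restr_to_subalg (D t) (F s)) = sigma_sets (space M) (cylinder_sets M W s \<union> null_sets M)"
      "sets (restr_to_subalg (D s) (F s)) = sigma_sets (space M) (cylinder_sets M W s \<union> null_sets M)"
      by (simp_all add: sets_restr_to_subalg[OF sub] sets_F_cylinder)
    show "range (\<lambda>_. space M) \<subseteq> cylinder_sets M W s \<union> null_sets M"
      by (auto simp: cylinder_sets_def intro!: exI[of _ "{}"] exI[of _ "\<lambda>_. {}"])
    have "space M \<in> sets (F s)"
      by (metis sets.top space_aug_filtration)
    then show "emeasure (restr_to_subalg (D t) (F s)) (space M) \<noteq> \<infinity>"
      using st nn_integral_exp_mart[of t \<theta>]
      by (simp add: emeasure_restr_to_subalg[OF sub] emD cong: nn_integral_cong)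
    fix C assume C: "C \<in> cylinder_sets M W s \<union> null_sets M"
    then have CF: "C \<in> sets (F s)"
      unfolding sets_F_cylinder by (rule sigma_sets.Basic)
    then have C_M: "C \<in> sets M" by (rule sets_F_imp)
    have "emeasure (D t) C = emeasure (D s) C"
    proof (cases "C \<in> null_sets M")
      case True
      then have "AE \<omega> in M. \<omega> \<notin> C" by (rule AE_not_in)
      then have "emeasure (D r) C = 0" if "0 \<le> r" for r
        unfolding emD[OF that C_M] by (subst nn_integral_0_iff_AE) (use that C_M in auto)
      then show ?thesis using st by simp
    next
      case False
      with C have C: "C \<in> cylinder_sets M W s" by simp
      \<comment> \<open>The value at \<open>t\<close> is the value at \<open>s\<close> times a
        factor of mean 1 that depends on the increment alone.\<close>
      have split: "ennreal (exp_mart \<theta> t \<omega>) = ennreal (exp_mart \<theta> s \<omega>) *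
          ennreal (exp (- \<theta> * (W t \<omega> - W s \<omega>) - \<theta>\<^sup>2 * (t - s) / 2))" for \<omega>
        by (simp add: exp_mart_def ennreal_mult[symmetric] exp_add[symmetric] field_simps)
      have "(\<integral>\<^sup>+\<omega>. ennreal (exp (- \<theta> * W s \<omega> - \<theta>\<^sup>2 * s / 2)) * indicator C \<omega> *
            ennreal (exp (- \<theta> * (W t \<omega> - W s \<omega>) - \<theta>\<^sup>2 * (t - s) / 2)) \<partial>M) =
          (\<integral>\<^sup>+\<omega>. ennreal (exp (- \<theta> * W s \<omega> - \<theta>\<^sup>2 * s / 2)) * indicator C \<omega> \<partial>M) *
          (\<integral>\<^sup>+\<omega>. ennreal (exp (- \<theta> * (W t \<omega> - W s \<omega>) - \<theta>\<^sup>2 * (t - s) / 2)) \<partial>M)"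
        by (rule nn_integral_cylinder_increment[OF C st',
            where v="\<lambda>y. ennreal (exp (- \<theta> * y - \<theta>\<^sup>2 * s / 2))"
              and u="\<lambda>y. ennreal (exp (- \<theta> * y - \<theta>\<^sup>2 * (t - s) / 2))"]) measurable
      then have "(\<integral>\<^sup>+\<omega>. ennreal (exp_mart \<theta> s \<omega>) * indicator C \<omega> *
            ennreal (exp (- \<theta> * (W t \<omega> - W s \<omega>) - \<theta>\<^sup>2 * (t - s) / 2)) \<partial>M) =
          (\<integral>\<^sup>+\<omega>. ennreal (exp_mart \<theta> s \<omega>) * indicator C \<omega> \<partial>M)"
        by (simp only: nn_integral_exp_increment[OF st'] mult_1_right flip: exp_mart_def)
      moreover have "(\<integral>\<^sup>+\<omega>. ennreal (exp_mart \<theta> t \<omega>) * indicator C \<omega> \<partial>M) =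
          (\<integral>\<^sup>+\<omega>. ennreal (exp_mart \<theta> s \<omega>) * indicator C \<omega> *
            ennreal (exp (- \<theta> * (W t \<omega> - W s \<omega>) - \<theta>\<^sup>2 * (t - s) / 2)) \<partial>M)"
        by (intro nn_integral_cong) (simp only: split mult_ac)
      ultimately show ?thesis
        using st C_M by (simp only: emD order_trans[OF st])
    qed
    then show "emeasure (restr_to_subalg (D t) (F s)) C = emeasure (restr_to_subalg (D s) (F s)) C"
      by (simp add: emeasure_restr_to_subalg[OF sub CF])
  qed auto
  then have "(\<integral>\<^sup>+\<omega>. H \<omega> \<partial>D t) = (\<integral>\<^sup>+\<omega>. H \<omega> \<partial>D s)"
    by (metis nn_integral_subalgebra2[OF sub H])
  then show ?thesis
    using st H_M by (simp add: D_def nn_integral_density)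
qed simp

text \<open>The martingale property replaces one factor of the square:
  \<open>E Z_s^2 1_G = E Z_t Z_s 1_G\<close>. Then \<open>2 Z_t Z_s \<le> Z_t^2 + Z_s^2\<close>
  applies, and one copy of the left side is cancelled, which calls for its finiteness.\<close>

lemma exp_mart_sq_submartingale:
  assumes st: "0 \<le> s" "s \<le> t" and G: "G \<in> sets (F s)"
  shows "(\<integral>\<^sup>+\<omega>. ennreal ((exp_mart \<theta> s \<omega>)\<^sup>2) * indicator G \<omega> \<partial>M) \<le>
    (\<integral>\<^sup>+\<omega>. ennreal ((exp_mart \<theta> t \<omega>)\<^sup>2) * indicator G \<omega> \<partial>M)" (is "?a \<le> ?b")
proof -
  have t: "0 \<le> t" using st by simp
  have [measurable]: "exp_mart \<theta> s \<in> borel_measurable M" "exp_mart \<theta> t \<in> borel_measurable M" "G \<in> sets M"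
    using st t G by (simp_all add: sets_F_imp)
  have "?a \<le> (\<integral>\<^sup>+\<omega>. ennreal ((exp_mart \<theta> s \<omega>)\<^sup>2) \<partial>M)"
    by (intro nn_integral_mono) (simp add: indicator_def)
  then have fin: "?a < \<infinity>"
    using nn_integral_exp_mart_sq[OF st(1), of \<theta>] by (auto intro: le_less_trans)
  have "?a = (\<integral>\<^sup>+\<omega>. ennreal (exp_mart \<theta> s \<omega>) * (ennreal (exp_mart \<theta> s \<omega>) * indicator G \<omega>) \<partial>M)"
    using exp_mart_pos by (intro nn_integral_cong) (simp add: power2_eq_square ennreal_mult less_imp_le mult.assoc)
  also have "\<dots> = (\<integral>\<^sup>+\<omega>. ennreal (exp_mart \<theta> t \<omega>) * (ennreal (exp_mart \<theta> s \<omega>) * indicator G \<omega>) \<partial>M)"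
  proof (rule exp_mart_martingale[OF st, symmetric])
    have [measurable]: "exp_mart \<theta> s \<in> borel_measurable (F s)" "G \<in> sets (F s)"
      using st G by (simp_all add: exp_mart_adapted)
    show "(\<lambda>\<omega>. ennreal (exp_mart \<theta> s \<omega>) * indicator G \<omega>) \<in> borel_measurable (F s)"
      by measurable
  qed
  finally have a: "?a = \<dots>" .
  have "?a + ?a = (\<integral>\<^sup>+\<omega>. 2 * (ennreal (exp_mart \<theta> t \<omega>) * (ennreal (exp_mart \<theta> s \<omega>) * indicator G \<omega>)) \<partial>M)"
    by (subst nn_integral_cmult) (measurable, simp add: a mult_2)
  also have "\<dots> \<le> (\<integral>\<^sup>+\<omega>. ennreal ((exp_mart \<theta> t \<omega>)\<^sup>2) * indicator G \<omega> + ennreal ((exp_mart \<theta> s \<omega>)\<^sup>2) * indicator G \<omega> \<partial>M)"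
  proof (intro nn_integral_mono)
    fix \<omega>
    have "2 * (exp_mart \<theta> t \<omega> * exp_mart \<theta> s \<omega>) \<le> (exp_mart \<theta> t \<omega>)\<^sup>2 + (exp_mart \<theta> s \<omega>)\<^sup>2"
      using sum_squares_bound[of "exp_mart \<theta> t \<omega>" "exp_mart \<theta> s \<omega>"] by simp
    then have "ennreal (2 * (exp_mart \<theta> t \<omega> * exp_mart \<theta> s \<omega>)) \<le> ennreal ((exp_mart \<theta> t \<omega>)\<^sup>2 + (exp_mart \<theta> s \<omega>)\<^sup>2)"
      by (rule ennreal_leI)
    then show "2 * (ennreal (exp_mart \<theta> t \<omega>) * (ennreal (exp_mart \<theta> s \<omega>) * indicator G \<omega>))
        \<le> ennreal ((exp_mart \<theta> t \<omega>)\<^sup>2) * indicator G \<omega> + ennreal ((exp_mart \<theta> s \<omega>)\<^sup>2) * indicator G \<omega>"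
      using exp_mart_pos[of \<theta> t \<omega>] exp_mart_pos[of \<theta> s \<omega>]
      by (auto simp: indicator_def ennreal_mult)
  qed
  also have "\<dots> = ?b + ?a"
    by (rule nn_integral_add) measurable
  finally show ?thesis
    using fin by (auto simp: ennreal_add_left_cancel_le add.commute[of ?b])
qed

text \<open>\<open>\<rho>\<close> is approximated from above by grid-valued stopping times. The second moments stay
  bounded along the approximation, so truncating \<open>Z\<close> at level \<open>K\<close> costs at most \<open>O(1/K)\<close>.
  Adaptedness of \<open>H\<close> means measurability with respect to the stopped sigma-algebra.\<close>

lemma optional_stopping:
  fixes \<rho> H :: "'a \<Rightarrow> real"
  assumes T: "0 < T"
    and range: "\<And>\<omega>. \<omega> \<in> space M \<Longrightarrow> 0 \<le> \<rho> \<omega> \<and> \<rho> \<omega> \<le> T"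
    and stop: "\<And>t. 0 \<le> t \<Longrightarrow> t \<le> T \<Longrightarrow> {\<omega>\<in>space M. \<rho> \<omega> \<le> t} \<in> sets (F t)"
    and H_bound: "\<And>\<omega>. \<omega> \<in> space M \<Longrightarrow> 0 \<le> H \<omega> \<and> H \<omega> \<le> 1"
    and H_adapted: "\<And>t. 0 \<le> t \<Longrightarrow> t \<le> T \<Longrightarrow>
      (\<lambda>\<omega>. H \<omega> * indicator {\<omega>\<in>space M. \<rho> \<omega> \<le> t} \<omega>) \<in> borel_measurable (F t)"
  shows "(\<integral>\<^sup>+\<omega>. ennreal (exp_mart \<theta> T \<omega> * H \<omega>) \<partial>M) = (\<integral>\<^sup>+\<omega>. ennreal (exp_mart \<theta> (\<rho> \<omega>) \<omega> * H \<omega>) \<partial>M)"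
proof -
  let ?Z = "exp_mart \<theta>"
  have [measurable]: "H \<in> borel_measurable M"
  proof -
    have "(\<lambda>\<omega>. H \<omega> * indicator {\<omega>\<in>space M. \<rho> \<omega> \<le> T} \<omega>) \<in> borel_measurable M"
      using H_adapted[of T] T by (intro measurable_F_imp[of _ T]) simp
    also have "?this \<longleftrightarrow> ?thesis"
      using range by (intro measurable_cong) (simp add: indicator_def)
    finally show ?thesis .
  qed
  define grid where "grid n i = T * real i / real (Suc n)" for n i
  \<comment> \<open>The ceiling rounds \<open>\<rho>\<close> up: whether \<open>\<rho>\<close> has
    occurred by a grid time is known at that time, so the result is again a stopping time.\<close>
  define idx where "idx n \<omega> = nat \<lceil>real (Suc n) * \<rho> \<omega> / T\<rceil>" for n \<omega>
  define G where "G n i = {\<omega>\<in>space M. idx n \<omega> = i}" for n i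
  define stp where "stp n \<omega> = grid n (idx n \<omega>)" for n \<omega>
  have grid_range: "0 \<le> grid n i" "i \<le> Suc n \<Longrightarrow> grid n i \<le> T" for n i
    using T by (auto simp: grid_def pos_divide_le_eq mult_left_mono simp del: of_nat_Suc)
  have grid_mono: "i \<le> j \<Longrightarrow> grid n i \<le> grid n j" for n i j
    using T by (simp add: grid_def divide_right_mono)
  have idx_le_iff: "idx n \<omega> \<le> i \<longleftrightarrow> \<rho> \<omega> \<le> grid n i" for n i \<omega>
  proof -
    have "idx n \<omega> \<le> i \<longleftrightarrow> real (Suc n) * \<rho> \<omega> / T \<le> real i"
      unfolding idx_def by (simp add: ceiling_le_iff nat_le_iff del: of_nat_Suc)
    also have "\<dots> \<longleftrightarrow> \<rho> \<omega> \<le> grid n i"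
      using T unfolding grid_def by (simp add: field_simps del: of_nat_Suc)
    finally show ?thesis .
  qed
  have idx_le: "idx n \<omega> \<le> Suc n" if "\<omega> \<in> space M" for n \<omega>
    unfolding idx_le_iff using range[OF that] T by (simp add: grid_def)
  have le_stp: "\<rho> \<omega> \<le> stp n \<omega>" for n \<omega>
    unfolding stp_def using idx_le_iff by blast
  have stp_le: "stp n \<omega> \<le> \<rho> \<omega> + T * (1 / real (Suc n))" if "\<omega> \<in> space M" for n \<omega>
  proof (cases "idx n \<omega>")
    case 0
    then show ?thesis using range[OF that] T by (simp add: stp_def grid_def)
  next
    case (Suc k)
    then have "grid n k < \<rho> \<omega>"
      using idx_le_iff[of n \<omega> k] by simp
    then show ?thesis
      by (simp add: stp_def Suc grid_def add_divide_distrib distrib_left)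
  qed
  have stp_lim: "(\<lambda>n. stp n \<omega>) \<longlonglongrightarrow> \<rho> \<omega>" if "\<omega> \<in> space M" for \<omega>
  proof (rule tendsto_sandwich[of "\<lambda>_. \<rho> \<omega>" _ _ "\<lambda>n. \<rho> \<omega> + T * (1 / real (Suc n))"])
    have "(\<lambda>n. \<rho> \<omega> + T * (1 / real (Suc n))) \<longlonglongrightarrow> \<rho> \<omega> + T * 0"
      using LIMSEQ_inverse_real_of_nat by (intro tendsto_intros) (simp add: inverse_eq_divide)
    then show "(\<lambda>n. \<rho> \<omega> + T * (1 / real (Suc n))) \<longlonglongrightarrow> \<rho> \<omega>" by simp
  qed (use le_stp stp_le[OF that] in \<open>simp_all only: eventually_True tendsto_const\<close>)
  have Z_lim: "(\<lambda>n. ?Z (stp n \<omega>) \<omega>) \<longlonglongrightarrow> ?Z (\<rho> \<omega>) \<omega>" if "\<omega> \<in> space M" for \<omega>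
    using exp_mart_continuous[OF that] range[OF that] le_stp[of \<omega>]
    by (intro continuous_on_tendsto_compose[OF _ stp_lim[OF that]]) (auto intro: always_eventually order_trans)
  have idx_set: "{\<omega>\<in>space M. idx n \<omega> \<le> j} \<in> sets (F (grid n i))" if "j \<le> i" "i \<le> Suc n" for n i j
    unfolding idx_le_iff using that
    by (intro subsetD[OF sets_F_mono[OF grid_mono[of j i]]] stop grid_range) auto
  have G_F: "G n i \<in> sets (F (grid n i))" if "i \<le> Suc n" for n i
  proof -
    have "G n i = {\<omega>\<in>space M. idx n \<omega> \<le> i} - (\<Union>j<i. {\<omega>\<in>space M. idx n \<omega> \<le> j})"
      by (auto simp: G_def) (metis lessThan_iff nat_less_le order_refl)
    also have "\<dots> \<in> sets (F (grid n i))"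
      using that by (intro sets.Diff sets.finite_UN idx_set) auto
    finally show ?thesis .
  qed
  have G_M [measurable]: "G n i \<in> sets M" for n i
  proof (cases "i \<le> Suc n")
    case False
    then have "G n i = {}" using idx_le by (auto simp: G_def)
    then show ?thesis by simp
  qed (use G_F sets_F_imp in blast)
  have Z_grid [measurable]: "?Z (grid n i) \<in> borel_measurable M" for n i
    using grid_range by simp
  have Z_T [measurable]: "?Z T \<in> borel_measurable M"
    using T by simp
  have split_idx: "(\<integral>\<^sup>+\<omega>. K (idx n \<omega>) \<omega> \<partial>M) = (\<Sum>i\<le>Suc n. \<integral>\<^sup>+\<omega>. K i \<omega> * indicator (G n i) \<omega> \<partial>M)"
    if [measurable]: "\<And>i. K i \<in> borel_measurable M" for K :: "nat \<Rightarrow> 'a \<Rightarrow> ennreal" and n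
  proof -
    have "(\<integral>\<^sup>+\<omega>. K (idx n \<omega>) \<omega> \<partial>M) = (\<integral>\<^sup>+\<omega>. (\<Sum>i\<le>Suc n. K i \<omega> * indicator (G n i) \<omega>) \<partial>M)"
    proof (intro nn_integral_cong)
      fix \<omega> assume \<omega>: "\<omega> \<in> space M"
      have "(\<Sum>i\<le>Suc n. K i \<omega> * indicator (G n i) \<omega>) = (\<Sum>i\<in>{idx n \<omega>}. K i \<omega> * indicator (G n i) \<omega>)"
        using idx_le[OF \<omega>] by (intro sum.mono_neutral_right) (auto simp: G_def indicator_def)
      then show "K (idx n \<omega>) \<omega> = (\<Sum>i\<le>Suc n. K i \<omega> * indicator (G n i) \<omega>)"
        using \<omega> by (simp add: G_def)
    qed
    also have "\<dots> = (\<Sum>i\<le>Suc n. \<integral>\<^sup>+\<omega>. K i \<omega> * indicator (G n i) \<omega> \<partial>M)"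
      by (rule nn_integral_sum) measurable
    finally show ?thesis .
  qed
  have eq: "(\<integral>\<^sup>+\<omega>. ennreal (?Z (stp n \<omega>) \<omega> * H \<omega>) \<partial>M) = (\<integral>\<^sup>+\<omega>. ennreal (?Z T \<omega> * H \<omega>) \<partial>M)" for n
  proof -
    have step: "(\<integral>\<^sup>+\<omega>. ennreal (?Z (grid n i) \<omega> * H \<omega>) * indicator (G n i) \<omega> \<partial>M) =
        (\<integral>\<^sup>+\<omega>. ennreal (?Z T \<omega> * H \<omega>) * indicator (G n i) \<omega> \<partial>M)" if i: "i \<le> Suc n" for i
    proof -
      \<comment> \<open>On \<open>G n i\<close> one has \<open>\<rho> \<le> grid n i\<close>, so the
        extra indicator changes nothing while making \<open>H\<close> measurable at that grid
        time.\<close>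
      have eq: "ennreal (?Z t \<omega> * H \<omega>) * indicator (G n i) \<omega> = ennreal (?Z t \<omega>) *
          (ennreal (H \<omega> * indicator {\<omega>\<in>space M. \<rho> \<omega> \<le> grid n i} \<omega>) * indicator (G n i) \<omega>)" for t \<omega>
        using exp_mart_pos[of \<theta> t \<omega>] H_bound[of \<omega>] idx_le_iff[of n \<omega> i]
        by (auto simp: indicator_def G_def ennreal_mult)
      have [measurable]: "(\<lambda>\<omega>. H \<omega> * indicator {\<omega>\<in>space M. \<rho> \<omega> \<le> grid n i} \<omega>) \<in> borel_measurable (F (grid n i))"
        "G n i \<in> sets (F (grid n i))"
        using H_adapted grid_range G_F i by auto
      show ?thesis
        unfolding eq using grid_range i by (intro exp_mart_martingale[symmetric]) (auto, measurable)
    qed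
    have "(\<integral>\<^sup>+\<omega>. ennreal (?Z (stp n \<omega>) \<omega> * H \<omega>) \<partial>M) =
        (\<Sum>i\<le>Suc n. \<integral>\<^sup>+\<omega>. ennreal (?Z (grid n i) \<omega> * H \<omega>) * indicator (G n i) \<omega> \<partial>M)"
      unfolding stp_def by (rule split_idx[of "\<lambda>i \<omega>. ennreal (?Z (grid n i) \<omega> * H \<omega>)"]) measurable
    also have "\<dots> = (\<Sum>i\<le>Suc n. \<integral>\<^sup>+\<omega>. ennreal (?Z T \<omega> * H \<omega>) * indicator (G n i) \<omega> \<partial>M)"
      using step by (intro sum.cong) auto
    also have "\<dots> = (\<integral>\<^sup>+\<omega>. ennreal (?Z T \<omega> * H \<omega>) \<partial>M)"
      by (rule split_idx[of "\<lambda>i \<omega>. ennreal (?Z T \<omega> * H \<omega>)", symmetric]) measurable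
    finally show ?thesis .
  qed
  have sq: "(\<integral>\<^sup>+\<omega>. ennreal ((?Z (stp n \<omega>) \<omega>)\<^sup>2) \<partial>M) \<le> ennreal (exp (\<theta>\<^sup>2 * T))" for n
  proof -
    have "(\<integral>\<^sup>+\<omega>. ennreal ((?Z (stp n \<omega>) \<omega>)\<^sup>2) \<partial>M) =
        (\<Sum>i\<le>Suc n. \<integral>\<^sup>+\<omega>. ennreal ((?Z (grid n i) \<omega>)\<^sup>2) * indicator (G n i) \<omega> \<partial>M)"
      unfolding stp_def by (rule split_idx[of "\<lambda>i \<omega>. ennreal ((?Z (grid n i) \<omega>)\<^sup>2)"]) measurable
    also have "\<dots> \<le> (\<Sum>i\<le>Suc n. \<integral>\<^sup>+\<omega>. ennreal ((?Z T \<omega>)\<^sup>2) * indicator (G n i) \<omega> \<partial>M)"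
      using grid_range G_F by (intro sum_mono exp_mart_sq_submartingale) auto
    also have "\<dots> = (\<integral>\<^sup>+\<omega>. ennreal ((?Z T \<omega>)\<^sup>2) \<partial>M)"
      by (rule split_idx[of "\<lambda>i \<omega>. ennreal ((?Z T \<omega>)\<^sup>2)", symmetric]) measurable
    finally show ?thesis
      using nn_integral_exp_mart_sq[of T \<theta>] T by simp
  qed
  have idx_meas [measurable]: "idx n \<in> measurable M (count_space UNIV)" for n
  proof (rule measurable_count_space_eq2_countable[THEN iffD2], safe)
    fix i
    have "idx n -` {i} \<inter> space M = G n i" by (auto simp: G_def)
    then show "idx n -` {i} \<inter> space M \<in> sets M" by simp
  qed auto
  have Z_stp [measurable]: "(\<lambda>\<omega>. ?Z (stp n \<omega>) \<omega>) \<in> borel_measurable M" for n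
    unfolding stp_def by (rule measurable_compose_countable[where f="\<lambda>i. ?Z (grid n i)"]) measurable
  have Z_rho [measurable]: "(\<lambda>\<omega>. ?Z (\<rho> \<omega>) \<omega>) \<in> borel_measurable M"
    by (rule borel_measurable_LIMSEQ_real[OF Z_lim Z_stp])
  show ?thesis
  proof (rule antisym)
    show "(\<integral>\<^sup>+\<omega>. ennreal (?Z T \<omega> * H \<omega>) \<partial>M) \<le> (\<integral>\<^sup>+\<omega>. ennreal (?Z (\<rho> \<omega>) \<omega> * H \<omega>) \<partial>M)"
    proof (rule ennreal_le_epsilon)
      fix e :: real assume e: "0 < e"
      \<comment> \<open>Where \<open>Z\<close> exceeds \<open>K\<close> one has
        \<open>Z \<le> Z^2 / K\<close>, so the part cut off has mean at most
        \<open>exp(\<theta>^2 T) / K = e\<close>.\<close>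
      define K where "K = exp (\<theta>\<^sup>2 * T) / e"
      have K: "0 < K" using e by (simp add: K_def)
      have bound: "(\<integral>\<^sup>+\<omega>. ennreal (?Z T \<omega> * H \<omega>) \<partial>M) \<le>
          (\<integral>\<^sup>+\<omega>. ennreal (min (?Z (stp n \<omega>) \<omega>) K * H \<omega>) \<partial>M) + ennreal e" for n
      proof -
        have "(\<integral>\<^sup>+\<omega>. ennreal (?Z T \<omega> * H \<omega>) \<partial>M) = (\<integral>\<^sup>+\<omega>. ennreal (?Z (stp n \<omega>) \<omega> * H \<omega>) \<partial>M)"
          by (rule eq[symmetric])
        also have "\<dots> \<le> (\<integral>\<^sup>+\<omega>. ennreal (min (?Z (stp n \<omega>) \<omega>) K * H \<omega>) + ennreal (1 / K) * ennreal ((?Z (stp n \<omega>) \<omega>)\<^sup>2) \<partial>M)"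
        proof (intro nn_integral_mono)
          fix \<omega> assume \<omega>: "\<omega> \<in> space M"
          define z where "z = ?Z (stp n \<omega>) \<omega>"
          have z: "0 < z" unfolding z_def by (rule exp_mart_pos)
          have "z * H \<omega> \<le> min z K * H \<omega> + 1 / K * z\<^sup>2"
          proof (cases "z \<le> K")
            case True
            then show ?thesis using K by (simp add: min_def)
          next
            case False
            then have "1 \<le> z / K" using K by simp
            then have "z * 1 \<le> z * (z / K)" using z by (intro mult_left_mono) auto
            moreover have "z * H \<omega> \<le> z" using z H_bound[OF \<omega>] by simp
            ultimately have "z * H \<omega> \<le> 1 / K * z\<^sup>2" by (simp add: power2_eq_square)
            moreover have "0 \<le> min z K * H \<omega>" using z K H_bound[OF \<omega>] by simp
            ultimately show ?thesis by linarith
          qed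
          then have "ennreal (z * H \<omega>) \<le> ennreal (min z K * H \<omega> + 1 / K * z\<^sup>2)"
            by (rule ennreal_leI)
          also have "\<dots> = ennreal (min z K * H \<omega>) + ennreal (1 / K) * ennreal (z\<^sup>2)"
            using z K H_bound[OF \<omega>] by (subst ennreal_plus) (auto simp: ennreal_mult[symmetric])
          finally show "ennreal (?Z (stp n \<omega>) \<omega> * H \<omega>) \<le>
              ennreal (min (?Z (stp n \<omega>) \<omega>) K * H \<omega>) + ennreal (1 / K) * ennreal ((?Z (stp n \<omega>) \<omega>)\<^sup>2)"
            by (simp add: z_def)
        qed
        also have "\<dots> = (\<integral>\<^sup>+\<omega>. ennreal (min (?Z (stp n \<omega>) \<omega>) K * H \<omega>) \<partial>M)
            + ennreal (1 / K) * (\<integral>\<^sup>+\<omega>. ennreal ((?Z (stp n \<omega>) \<omega>)\<^sup>2) \<partial>M)"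
          by (subst nn_integral_add) (simp_all add: nn_integral_cmult)
        also have "\<dots> \<le> (\<integral>\<^sup>+\<omega>. ennreal (min (?Z (stp n \<omega>) \<omega>) K * H \<omega>) \<partial>M)
            + ennreal (1 / K) * ennreal (exp (\<theta>\<^sup>2 * T))"
          by (intro add_left_mono mult_left_mono sq) simp
        also have "ennreal (1 / K) * ennreal (exp (\<theta>\<^sup>2 * T)) = ennreal e"
          using K e by (simp add: ennreal_mult[symmetric] K_def)
        finally show ?thesis .
      qed
      have "(\<lambda>n. \<integral>\<^sup>+\<omega>. ennreal (min (?Z (stp n \<omega>) \<omega>) K * H \<omega>) \<partial>M) \<longlonglongrightarrow>
          (\<integral>\<^sup>+\<omega>. ennreal (min (?Z (\<rho> \<omega>) \<omega>) K * H \<omega>) \<partial>M)"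
      proof (rule nn_integral_dominated_convergence[where w="\<lambda>_. ennreal K"])
        show "AE \<omega> in M. ennreal (min (?Z (stp n \<omega>) \<omega>) K * H \<omega>) \<le> ennreal K" for n
        proof (intro AE_I2 ennreal_leI)
          fix \<omega> assume \<omega>: "\<omega> \<in> space M"
          show "min (?Z (stp n \<omega>) \<omega>) K * H \<omega> \<le> K"
            using mult_mono[of "min (?Z (stp n \<omega>) \<omega>) K" K "H \<omega>" 1] K H_bound[OF \<omega>] by simp
        qed
        show "AE \<omega> in M. (\<lambda>n. ennreal (min (?Z (stp n \<omega>) \<omega>) K * H \<omega>)) \<longlonglongrightarrow> ennreal (min (?Z (\<rho> \<omega>) \<omega>) K * H \<omega>)"
          by (intro AE_I2 tendsto_ennrealI tendsto_intros Z_lim)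
      qed (simp_all add: emeasure_space_1)
      then have "(\<lambda>n. (\<integral>\<^sup>+\<omega>. ennreal (min (?Z (stp n \<omega>) \<omega>) K * H \<omega>) \<partial>M) + ennreal e) \<longlonglongrightarrow>
          (\<integral>\<^sup>+\<omega>. ennreal (min (?Z (\<rho> \<omega>) \<omega>) K * H \<omega>) \<partial>M) + ennreal e"
        by (intro tendsto_intros)
      then have "(\<integral>\<^sup>+\<omega>. ennreal (?Z T \<omega> * H \<omega>) \<partial>M) \<le>
          (\<integral>\<^sup>+\<omega>. ennreal (min (?Z (\<rho> \<omega>) \<omega>) K * H \<omega>) \<partial>M) + ennreal e"
        by (rule tendsto_lowerbound) (simp_all add: bound)
      also have "\<dots> \<le> (\<integral>\<^sup>+\<omega>. ennreal (?Z (\<rho> \<omega>) \<omega> * H \<omega>) \<partial>M) + ennreal e"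
        using H_bound by (intro add_right_mono nn_integral_mono ennreal_leI mult_right_mono) auto
      finally show "(\<integral>\<^sup>+\<omega>. ennreal (?Z T \<omega> * H \<omega>) \<partial>M) \<le> \<dots>" .
    qed
    have "(\<integral>\<^sup>+\<omega>. ennreal (?Z (\<rho> \<omega>) \<omega> * H \<omega>) \<partial>M) =
        (\<integral>\<^sup>+\<omega>. liminf (\<lambda>n. ennreal (?Z (stp n \<omega>) \<omega> * H \<omega>)) \<partial>M)"
      by (intro nn_integral_cong lim_imp_Liminf[symmetric] tendsto_ennrealI tendsto_intros Z_lim) simp_all
    \<comment> \<open>The converse inequality is Fatou's lemma along the same approximation.\<close>
    also have "\<dots> \<le> liminf (\<lambda>n. \<integral>\<^sup>+\<omega>. ennreal (?Z (stp n \<omega>) \<omega> * H \<omega>) \<partial>M)"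
      by (rule nn_integral_liminf) measurable
    finally show "(\<integral>\<^sup>+\<omega>. ennreal (?Z (\<rho> \<omega>) \<omega> * H \<omega>) \<partial>M) \<le> (\<integral>\<^sup>+\<omega>. ennreal (?Z T \<omega> * H \<omega>) \<partial>M)"
      by (simp add: eq Liminf_const)
  qed
qed

end

section \<open>The controlled surplus\<close>

locale dividend_control = brownian_motion M W
  for M :: "'a measure" and W :: "real \<Rightarrow> 'a \<Rightarrow> real" +
  fixes \<mu> \<sigma> r cbar x :: real and C :: "real \<Rightarrow> 'a \<Rightarrow> real"
  assumes r_pos: "0 < r" and cbar_pos: "0 < cbar" and x_nonneg: "0 \<le> x"
    and C_adapted: "\<And>t. 0 \<le> t \<Longrightarrow> C t \<in> borel_measurable (F t)"
    and C_cadlag: "\<And>\<omega>. \<omega> \<in> space M \<Longrightarrow> cadlag (\<lambda>t. C t \<omega>)"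
    and C_range: "\<And>\<omega> t. \<omega> \<in> space M \<Longrightarrow> 0 \<le> t \<Longrightarrow> ereal t \<le> ruin_time (surplus x \<mu> \<sigma> W C) \<omega>
      \<Longrightarrow> 0 \<le> C t \<omega> \<and> C t \<omega> \<le> cbar"
begin

abbreviation "X \<equiv> surplus x \<mu> \<sigma> W C"
abbreviation "\<tau> \<equiv> ruin_time X"

lemma C_right_continuous: "\<omega> \<in> space M \<Longrightarrow> 0 \<le> s \<Longrightarrow> continuous (at_right s) (\<lambda>t. C t \<omega>)"
  using C_cadlag by (simp add: cadlag_def)

lemma C_integrable: "\<omega> \<in> space M \<Longrightarrow> 0 \<le> t \<Longrightarrow> set_integrable lborel {0..t} (\<lambda>s. C s \<omega>)"
  by (intro cadlag_set_integrable C_cadlag)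

lemma const_integrable: "set_integrable lborel {0..t::real} (\<lambda>s. k :: real)"
  by (intro set_integrable_bounded_Icc[of _ _ _ "\<bar>k\<bar>"]) (auto simp: set_borel_measurable_def)

lemma X_0: "\<omega> \<in> space M \<Longrightarrow> X 0 \<omega> = x"
proof -
  assume "\<omega> \<in> space M"
  moreover have "(LBINT s:{0}. \<mu> - C s \<omega>) = 0"
    unfolding set_lebesgue_integral_def using AE_lborel_singleton[of 0]
    by (intro integral_eq_zero_AE) (auto elim!: eventually_mono)
  ultimately show ?thesis
    by (simp add: surplus_def W_0)
qed

lemma X_continuous:
  assumes "\<omega> \<in> space M"
  shows "continuous_on {0..} (\<lambda>t. X t \<omega>)"
proof -
  have "continuous_on {0..} (\<lambda>t. LBINT s:{0..t}. \<mu> - C s \<omega>)"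
    using assms by (intro continuous_on_indefinite_set_integral set_integral_diff const_integrable C_integrable)
  then show ?thesis
    unfolding surplus_def using assms by (intro continuous_intros W_continuous)
qed

text \<open>Only values up to \<open>t\<close> enter, so joint measurability holds over
  \<open>F t\<close> itself, and integrating out time preserves it.\<close>

lemma adapted_integral:
  fixes f :: "real \<Rightarrow> 'a \<Rightarrow> real"
  assumes "\<And>s. 0 \<le> s \<Longrightarrow> s \<le> t \<Longrightarrow> f s \<in> borel_measurable (F t)"
    and "\<And>\<omega> s. \<omega> \<in> space M \<Longrightarrow> 0 \<le> s \<Longrightarrow> continuous (at_right s) (\<lambda>s. f s \<omega>)" and "0 \<le> t"
  shows "(\<lambda>\<omega>. LBINT s:{0..t}. f s \<omega>) \<in> borel_measurable (F t)"
proof -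
  have "(\<lambda>(\<omega>, s). indicator {0..t} s * f s \<omega>) \<in> borel_measurable (F t \<Otimes>\<^sub>M lborel)"
    using assms by (intro borel_measurable_pair_right_continuous) auto
  then show ?thesis
    unfolding set_lebesgue_integral_def
    by (intro lborel.borel_measurable_lebesgue_integral) simp
qed

lemma X_adapted:
  assumes "0 \<le> s" "s \<le> t"
  shows "X s \<in> borel_measurable (F t)"
proof -
  have [measurable]: "(\<lambda>\<omega>. LBINT u:{0..s}. \<mu> - C u \<omega>) \<in> borel_measurable (F s)" "W s \<in> borel_measurable (F s)"
    using assms(1) C_adapted
    by (auto intro!: adapted_integral W_adapted borel_measurable_diff continuous_diff C_right_continuous
        intro: measurable_F_mono)
  have "X s \<in> borel_measurable (F s)"
    unfolding surplus_def by measurable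
  then show ?thesis using assms(2) by (rule measurable_F_mono)
qed

section \<open>The ruin time and killed rates\<close>

lemma \<tau>_nonneg: "0 \<le> \<tau> \<omega>"
  unfolding ruin_time_def by (intro Inf_greatest) auto

text \<open>If the path is positive on \<open>{0..t}\<close>, continuity keeps it positive a little
  beyond \<open>t\<close>, so the infimum lies strictly later. The event \<open>t < \<tau>\<close>
  thus depends only on the path up to \<open>t\<close>.\<close>

lemma less_\<tau>_iff:
  assumes \<omega>: "\<omega> \<in> space M" and t: "0 \<le> t"
  shows "ereal t < \<tau> \<omega> \<longleftrightarrow> (\<forall>s\<in>{0..t}. 0 < X s \<omega>)"
proof
  assume less: "ereal t < \<tau> \<omega>"
  show "\<forall>s\<in>{0..t}. 0 < X s \<omega>"
  proof (rule ballI, rule ccontr)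
    fix s assume s: "s \<in> {0..t}" "\<not> 0 < X s \<omega>"
    then have "\<tau> \<omega> \<le> ereal s"
      unfolding ruin_time_def by (intro Inf_lower) auto
    with s less show False
      by (meson atLeastAtMost_iff ereal_less_eq(3) leD le_less_trans less_le_trans)
  qed
next
  assume pos: "\<forall>s\<in>{0..t}. 0 < X s \<omega>"
  have "((\<lambda>s. X s \<omega>) \<longlongrightarrow> X t \<omega>) (at_right t)"
    using continuous_on_Ici_imp_at_right[OF X_continuous[OF \<omega>] t] by (simp add: continuous_within)
  moreover have "0 < X t \<omega>" using pos t by auto
  ultimately have "eventually (\<lambda>s. 0 < X s \<omega>) (at_right t)"
    by (rule order_tendstoD)
  then obtain e where e: "t < e" "\<And>s. t < s \<Longrightarrow> s < e \<Longrightarrow> 0 < X s \<omega>"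
    by (auto simp: eventually_at_right[of t "t + 1"])
  have "ereal e \<le> \<tau> \<omega>"
    unfolding ruin_time_def
  proof (rule Inf_greatest, clarsimp)
    fix s assume "0 \<le> s" "X s \<omega> \<le> 0"
    then show "e \<le> s"
      using pos e(2)[of s] by (cases "s \<le> t") force+
  qed
  with e(1) show "ereal t < \<tau> \<omega>"
    by (meson ereal_less_eq(3) less_ereal.simps(1) less_le_trans)
qed

lemma sets_less_\<tau>:
  assumes "0 \<le> t"
  shows "{\<omega>\<in>space M. ereal t < \<tau> \<omega>} \<in> sets (F t)"
proof -
  have "{\<omega>\<in>space (F t). \<forall>s\<in>{0..t}. 0 < X s \<omega>} \<in> sets (F t)"
    using assms X_adapted by (intro sets_all_pos_continuous continuous_on_subset[OF X_continuous]) auto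
  also have "{\<omega>\<in>space (F t). \<forall>s\<in>{0..t}. 0 < X s \<omega>} = {\<omega>\<in>space M. ereal t < \<tau> \<omega>}"
    using assms less_\<tau>_iff by auto
  finally show ?thesis .
qed

text \<open>The cut is at \<open>s < \<tau>\<close> rather than \<open>s \<le> \<tau>\<close>: the
  killed path is then 0 at ruin and stays right-continuous.\<close>

definition killed :: "(real \<Rightarrow> 'a \<Rightarrow> real) \<Rightarrow> real \<Rightarrow> 'a \<Rightarrow> real" where
  "killed f s \<omega> = (if ereal s < \<tau> \<omega> then f s \<omega> else 0)"

lemma killed_adapted:
  assumes "f s \<in> borel_measurable (F s)" "0 \<le> s" "s \<le> t"
  shows "killed f s \<in> borel_measurable (F t)"
proof -
  have "(\<lambda>\<omega>. if ereal s < \<tau> \<omega> then f s \<omega> else 0) \<in> borel_measurable (F s)"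
    using assms sets_less_\<tau>[of s] by (intro measurable_If) simp_all
  then show ?thesis
    unfolding killed_def using assms(3) by (rule measurable_F_mono)
qed

lemma killed_right_continuous:
  assumes f: "continuous (at_right s) (\<lambda>s. f s \<omega>)"
  shows "continuous (at_right s) (\<lambda>s. killed f s \<omega>)"
proof (cases "ereal s < \<tau> \<omega>")
  case True
  then obtain e where e: "ereal s < ereal e" "ereal e < \<tau> \<omega>"
    using ereal_dense2 by blast
  have "eventually (\<lambda>u. f u \<omega> = killed f u \<omega>) (at_right s)"
    unfolding eventually_at_right[of s e, OF e(1)[simplified]]
  proof (intro exI[of _ e] conjI allI impI)
    fix u assume "s < u" "u < e"
    then have "ereal u < \<tau> \<omega>"
      using e(2) by (meson less_ereal.simps(1) less_trans)
    then show "f u \<omega> = killed f u \<omega>" by (simp add: killed_def)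
  qed (use e in simp)
  moreover have "killed f s \<omega> = f s \<omega>" using True by (simp add: killed_def)
  ultimately show ?thesis
    using f by (simp add: continuous_within tendsto_cong)
next
  case False
  have "eventually (\<lambda>u. 0 = killed f u \<omega>) (at_right s)"
    unfolding eventually_at_filter
  proof (intro always_eventually allI impI)
    fix u assume "u \<in> {s<..}"
    then have "ereal s \<le> ereal u" by simp
    with False have "\<not> ereal u < \<tau> \<omega>" by (meson le_less_trans)
    then show "0 = killed f u \<omega>" by (simp add: killed_def)
  qed
  moreover have "killed f s \<omega> = 0" using False by (simp add: killed_def)
  ultimately show ?thesis
    using tendsto_cong[of "\<lambda>_. 0" "\<lambda>u. killed f u \<omega>" "at_right s" 0]
    by (simp add: continuous_within)
qed

text \<open>\<open>D\<close> and \<open>R\<close> vanish after ruin, where admissibility does not constrain \<open>C\<close>.\<close>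

definition D :: "real \<Rightarrow> 'a \<Rightarrow> real" where "D = killed (\<lambda>s \<omega>. cbar - C s \<omega>)"
definition R :: "real \<Rightarrow> 'a \<Rightarrow> real" where "R = killed C"
definition B :: "real \<Rightarrow> 'a \<Rightarrow> real" where "B t \<omega> = (LBINT s:{0..t}. D s \<omega>)"

lemma D_range: "\<omega> \<in> space M \<Longrightarrow> 0 \<le> s \<Longrightarrow> 0 \<le> D s \<omega> \<and> D s \<omega> \<le> cbar"
  using C_range[of \<omega> s] cbar_pos by (auto simp: D_def killed_def)

lemma R_range: "\<omega> \<in> space M \<Longrightarrow> 0 \<le> s \<Longrightarrow> 0 \<le> R s \<omega> \<and> R s \<omega> \<le> cbar"
  using C_range[of \<omega> s] cbar_pos by (auto simp: R_def killed_def)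

lemma D_adapted: "0 \<le> s \<Longrightarrow> s \<le> t \<Longrightarrow> D s \<in> borel_measurable (F t)"
  unfolding D_def using C_adapted[of s] by (intro killed_adapted) auto

lemma R_adapted: "0 \<le> s \<Longrightarrow> s \<le> t \<Longrightarrow> R s \<in> borel_measurable (F t)"
  unfolding R_def using C_adapted[of s] by (intro killed_adapted) auto

lemma D_right_continuous: "\<omega> \<in> space M \<Longrightarrow> 0 \<le> s \<Longrightarrow> continuous (at_right s) (\<lambda>s. D s \<omega>)"
  unfolding D_def by (intro killed_right_continuous continuous_diff continuous_const C_right_continuous)

lemma R_right_continuous: "\<omega> \<in> space M \<Longrightarrow> 0 \<le> s \<Longrightarrow> continuous (at_right s) (\<lambda>s. R s \<omega>)"
  unfolding R_def by (intro killed_right_continuous C_right_continuous)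

lemma D_integrable: "\<omega> \<in> space M \<Longrightarrow> 0 \<le> t \<Longrightarrow> set_integrable lborel {0..t} (\<lambda>s. D s \<omega>)"
  using D_range by (intro set_integrable_bounded_Icc[of _ _ _ cbar] set_borel_measurable_right_continuous D_right_continuous) auto

lemma B_adapted: "0 \<le> s \<Longrightarrow> s \<le> t \<Longrightarrow> B s \<in> borel_measurable (F t)"
  unfolding B_def
  by (rule measurable_F_mono[OF adapted_integral]) (auto intro: D_adapted D_right_continuous)

lemma B_continuous: "\<omega> \<in> space M \<Longrightarrow> continuous_on {0..} (\<lambda>t. B t \<omega>)"
  unfolding B_def by (intro continuous_on_indefinite_set_integral D_integrable)

lemma B_nonneg: "\<omega> \<in> space M \<Longrightarrow> 0 \<le> B t \<omega>"
  unfolding B_def set_lebesgue_integral_def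
  using D_range by (intro integral_nonneg_AE AE_I2) (auto simp: indicator_def)

lemma X_eq:
  assumes \<omega>: "\<omega> \<in> space M" and t: "0 \<le> t" "ereal t \<le> \<tau> \<omega>"
  shows "X t \<omega> = x + (\<mu> - cbar) * t + B t \<omega> + \<sigma> * W t \<omega>"
proof -
  have "B t \<omega> = (LBINT s:{0..t}. cbar - C s \<omega>)"
    unfolding B_def set_lebesgue_integral_def
  proof (rule integral_cong_AE)
    \<comment> \<open>Equality can fail at \<open>s = t\<close> when \<open>t = \<tau>\<close>, as
      \<open>D\<close> is already 0 there; a single time does not affect the integral.\<close>
    show "AE s in lborel. indicator {0..t} s *\<^sub>R D s \<omega> = indicator {0..t} s *\<^sub>R (cbar - C s \<omega>)"
      using AE_lborel_singleton[of t]
    proof eventually_elim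
      fix s assume "s \<noteq> t"
      moreover have "ereal s < \<tau> \<omega>" if "s < t"
        using that t(2) by (meson less_ereal.simps(1) less_le_trans)
      ultimately show "indicator {0..t} s *\<^sub>R D s \<omega> = indicator {0..t} s *\<^sub>R (cbar - C s \<omega>)"
        by (auto simp: indicator_def D_def killed_def)
    qed
    show "(\<lambda>s. indicator {0..t} s *\<^sub>R D s \<omega>) \<in> borel_measurable lborel"
      using D_integrable[OF \<omega> t(1)] by (auto simp: set_integrable_def)
    show "(\<lambda>s. indicator {0..t} s *\<^sub>R (cbar - C s \<omega>)) \<in> borel_measurable lborel"
      using set_integral_diff(1)[OF const_integrable C_integrable[OF \<omega> t(1)], of cbar] by (auto simp: set_integrable_def)
  qed
  also have "\<dots> = (LBINT s:{0..t}. \<mu> - C s \<omega>) - (LBINT s:{0..t}. \<mu> - cbar)"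
    using \<omega> t by (subst set_integral_diff(2)[symmetric])
      (auto intro!: set_integral_diff(1) const_integrable C_integrable)
  also have "(LBINT s:{0..t}. \<mu> - cbar) = (\<mu> - cbar) * t"
    using t by (simp add: set_lebesgue_integral_def)
  finally show ?thesis by (simp add: surplus_def)
qed

section \<open>The bounded stopping time \<open>min \<tau> T\<close>\<close>

definition \<rho> :: "real \<Rightarrow> 'a \<Rightarrow> real" where
  "\<rho> T \<omega> = (if ereal T < \<tau> \<omega> then T else real_of_ereal (\<tau> \<omega>))"

text \<open>The default value of \<open>real_of_ereal\<close> at infinity never occurs, because that
  branch has \<open>\<tau> \<le> T\<close>.\<close>

lemma ereal_\<rho>: "ereal (\<rho> T \<omega>) = min (\<tau> \<omega>) (ereal T)"
  using \<tau>_nonneg[of \<omega>] by (cases "\<tau> \<omega>") (auto simp: \<rho>_def min_def)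

lemma \<rho>_range: "0 \<le> T \<Longrightarrow> 0 \<le> \<rho> T \<omega> \<and> \<rho> T \<omega> \<le> T"
  using ereal_\<rho>[of T \<omega>] \<tau>_nonneg[of \<omega>]
  by (metis ereal_less_eq(3) min.cobounded2 min.boundedI zero_ereal_def)

lemma \<rho>_le_\<tau>: "ereal (\<rho> T \<omega>) \<le> \<tau> \<omega>"
  by (simp add: ereal_\<rho>)

lemma \<rho>_le_iff: "t < T \<Longrightarrow> \<rho> T \<omega> \<le> t \<longleftrightarrow> \<not> ereal t < \<tau> \<omega>"
  unfolding ereal_less_eq(3)[symmetric] ereal_\<rho> by (auto simp: min_le_iff_disj not_less)

lemma \<rho>_stopping:
  assumes "0 \<le> t" "t \<le> T"
  shows "{\<omega>\<in>space M. \<rho> T \<omega> \<le> t} \<in> sets (F t)"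
proof (cases "t = T")
  case True
  then have "{\<omega>\<in>space M. \<rho> T \<omega> \<le> t} = space (F t)"
    using \<rho>_range assms by auto
  then show ?thesis by (metis sets.top)
next
  case False
  then have "{\<omega>\<in>space M. \<rho> T \<omega> \<le> t} = space (F t) - {\<omega>\<in>space M. ereal t < \<tau> \<omega>}"
    using assms by (auto simp: \<rho>_le_iff)
  then show ?thesis
    using sets_less_\<tau>[OF assms(1)] by (metis sets.compl_sets)
qed

lemma \<rho>_measurable [measurable]:
  assumes T: "0 \<le> T"
  shows "\<rho> T \<in> borel_measurable M"
proof (rule borel_measurableI_le)
  fix a
  have "{\<omega>\<in>space M. \<rho> T \<omega> \<le> a} = {\<omega>\<in>space M. \<rho> T \<omega> \<le> min a T}"
    using \<rho>_range[OF T] by auto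
  moreover have "{\<omega>\<in>space M. \<rho> T \<omega> \<le> min a T} \<in> sets M"
  proof (cases "0 \<le> a")
    case True
    then show ?thesis using T by (intro sets_F_imp[OF \<rho>_stopping]) auto
  next
    case False
    then have "{\<omega>\<in>space M. \<rho> T \<omega> \<le> min a T} = {}"
      using \<rho>_range[OF T] by (smt (verit) empty_Collect_eq min.cobounded1)
    then show ?thesis by (metis sets.empty_sets)
  qed
  ultimately show "{\<omega>\<in>space M. \<rho> T \<omega> \<le> a} \<in> sets M" by simp
qed

text \<open>Before ruin the surplus is positive, and continuity carries the weak inequality to the
  endpoint. If \<open>\<rho> T \<omega> = 0\<close> there is no earlier time and
  \<open>x \<ge> 0\<close> decides.\<close>

lemma X_\<rho>_nonneg:
  assumes \<omega>: "\<omega> \<in> space M" and T: "0 \<le> T"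
  shows "0 \<le> X (\<rho> T \<omega>) \<omega>"
proof (cases "\<rho> T \<omega> = 0")
  case True
  then show ?thesis using X_0[OF \<omega>] x_nonneg by simp
next
  case False
  then have \<rho>: "0 < \<rho> T \<omega>" using \<rho>_range[OF T, of \<omega>] by simp
  have "closure {0..<\<rho> T \<omega>} = {0..\<rho> T \<omega>}" using \<rho> by simp
  moreover have "0 \<le> X s \<omega>" if "s \<in> {0..<\<rho> T \<omega>}" for s
  proof -
    have "ereal s < \<tau> \<omega>"
      using that \<rho>_le_\<tau>[of T \<omega>] by (metis atLeastLessThan_iff less_ereal.simps(1) less_le_trans)
    then show ?thesis
      using less_\<tau>_iff[OF \<omega>, of s] that by (auto intro: less_imp_le)
  qed
  ultimately show ?thesis
    using continuous_ge_on_closure[of "{0..<\<rho> T \<omega>}" "\<lambda>s. X s \<omega>" "\<rho> T \<omega>" 0] \<rho>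
      continuous_on_subset[OF X_continuous[OF \<omega>], of "{0..\<rho> T \<omega>}"] by auto
qed

text \<open>Some time up to \<open>\<rho>\<close> has a nonpositive surplus, and it cannot precede
  ruin, so it is \<open>\<rho>\<close> itself; nonnegativity there gives equality.\<close>

lemma X_\<rho>_ruined:
  assumes \<omega>: "\<omega> \<in> space M" and T: "0 \<le> T" and ruin: "\<not> ereal T < \<tau> \<omega>"
  shows "X (\<rho> T \<omega>) \<omega> = 0"
proof -
  have \<rho>: "ereal (\<rho> T \<omega>) = \<tau> \<omega>" using ruin by (simp add: ereal_\<rho> min_absorb1)
  then have "\<not> ereal (\<rho> T \<omega>) < \<tau> \<omega>" by simp
  then obtain s where s: "s \<in> {0..\<rho> T \<omega>}" "X s \<omega> \<le> 0"
    using less_\<tau>_iff[OF \<omega>, of "\<rho> T \<omega>"] \<rho>_range[OF T, of \<omega>] by (meson not_less)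
  have "\<not> ereal s < \<tau> \<omega>"
    using less_\<tau>_iff[OF \<omega>, of s] s by force
  then have "s = \<rho> T \<omega>"
    using s(1) unfolding \<rho>[symmetric] by simp
  then show ?thesis
    using s(2) X_\<rho>_nonneg[OF \<omega> T] by simp
qed

text \<open>\<open>D\<close> vanishes from ruin on, so \<open>B\<close> is frozen. Hence
  \<open>B T\<close> is already known at \<open>\<rho> T\<close>, as optional stopping demands of
  \<open>H\<close>.\<close>

lemma B_after_\<rho>:
  assumes "\<rho> T \<omega> \<le> t" "t \<le> T"
  shows "B t \<omega> = B (\<rho> T \<omega>) \<omega>"
proof -
  have "indicator {0..t} s *\<^sub>R D s \<omega> = indicator {0..\<rho> T \<omega>} s *\<^sub>R D s \<omega>" for s
  proof (cases "\<rho> T \<omega> < s \<and> s \<le> t")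
    case True
    then have "\<not> ereal s < \<tau> \<omega>"
      using assms(2) ereal_\<rho>[of T \<omega>] by (cases "\<tau> \<omega>") (auto simp: min_def split: if_splits)
    then show ?thesis by (simp add: D_def killed_def)
  qed (use assms in \<open>auto simp: indicator_def\<close>)
  then show ?thesis
    unfolding B_def set_lebesgue_integral_def by (simp only:)
qed

section \<open>The discounted surplus and bounds involving \<open>E exp(-r \<rho>)\<close>\<close>

lemma exp_surplus:
  assumes \<omega>: "\<omega> \<in> space M" and t: "0 \<le> t" "ereal t \<le> \<tau> \<omega>"
    and \<gamma>: "(\<gamma> * \<sigma>)\<^sup>2 / 2 = \<gamma> * (\<mu> - cbar) + r"
  shows "exp (- \<gamma> * x) * (exp_mart (\<gamma> * \<sigma>) t \<omega> * exp (- \<gamma> * B t \<omega>)) = exp (- r * t - \<gamma> * X t \<omega>)"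
proof -
  have "(\<gamma> * \<sigma>)\<^sup>2 * t / 2 = (\<gamma> * (\<mu> - cbar) + r) * t"
    using \<gamma> by (metis times_divide_eq_left)
  then show ?thesis
    unfolding exp_mart_def exp_add[symmetric] X_eq[OF \<omega> t] by (simp add: algebra_simps)
qed

lemma pair_measurable:
  fixes f :: "real \<Rightarrow> 'a \<Rightarrow> real"
  assumes "\<And>s. 0 \<le> s \<Longrightarrow> f s \<in> borel_measurable (F s)"
    and "\<And>\<omega> s. \<omega> \<in> space M \<Longrightarrow> 0 \<le> s \<Longrightarrow> continuous (at_right s) (\<lambda>s. f s \<omega>)" and "0 \<le> T"
  shows "(\<lambda>(\<omega>, s). indicator {0..T} s * f s \<omega>) \<in> borel_measurable (M \<Otimes>\<^sub>M lborel)"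
  using assms by (intro borel_measurable_pair_right_continuous) (auto intro: measurable_F_imp)

lemma stopped_measurable:
  fixes f :: "real \<Rightarrow> 'a \<Rightarrow> real"
  assumes f: "\<And>s. 0 \<le> s \<Longrightarrow> f s \<in> borel_measurable (F s)"
    "\<And>\<omega> s. \<omega> \<in> space M \<Longrightarrow> 0 \<le> s \<Longrightarrow> continuous (at_right s) (\<lambda>s. f s \<omega>)" and T: "0 \<le> T"
  shows "(\<lambda>\<omega>. f (\<rho> T \<omega>) \<omega>) \<in> borel_measurable M"
proof -
  have "(\<lambda>\<omega>. (\<omega>, \<rho> T \<omega>)) \<in> M \<rightarrow>\<^sub>M M \<Otimes>\<^sub>M lborel"
    using T by measurable
  from measurable_compose[OF this pair_measurable[OF f T]]
  show ?thesis
    using \<rho>_range[OF T] by (simp add: indicator_def)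
qed

lemma stopped_exp_B_measurable [measurable]:
  assumes "0 \<le> T"
  shows "(\<lambda>\<omega>. exp_mart \<theta> (\<rho> T \<omega>) \<omega> * exp (- \<gamma> * B (\<rho> T \<omega>) \<omega>)) \<in> borel_measurable M"
proof (rule stopped_measurable[OF _ _ assms])
  fix s :: real assume s: "0 \<le> s"
  show "(\<lambda>\<omega>. exp_mart \<theta> s \<omega> * exp (- \<gamma> * B s \<omega>)) \<in> borel_measurable (F s)"
    using exp_mart_adapted[OF s order_refl, of \<theta>] B_adapted[OF s order_refl] by measurable
  show "continuous (at_right s) (\<lambda>s. exp_mart \<theta> s \<omega> * exp (- \<gamma> * B s \<omega>))" if "\<omega> \<in> space M" for \<omega>
    using that s by (intro continuous_on_Ici_imp_at_right continuous_intros exp_mart_continuous B_continuous)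
qed

lemma stopped_exp_B:
  assumes \<gamma>: "0 \<le> \<gamma>" and T: "0 < T"
  shows "(\<integral>\<^sup>+\<omega>. ennreal (exp_mart \<theta> T \<omega> * exp (- \<gamma> * B T \<omega>)) \<partial>M) =
    (\<integral>\<^sup>+\<omega>. ennreal (exp_mart \<theta> (\<rho> T \<omega>) \<omega> * exp (- \<gamma> * B (\<rho> T \<omega>) \<omega>)) \<partial>M)"
proof -
  have B_T: "B T \<omega> = B (\<rho> T \<omega>) \<omega>" for \<omega>
    using \<rho>_range[of T \<omega>] T by (intro B_after_\<rho>) auto
  have "(\<integral>\<^sup>+\<omega>. ennreal (exp_mart \<theta> T \<omega> * exp (- \<gamma> * B T \<omega>)) \<partial>M) =
    (\<integral>\<^sup>+\<omega>. ennreal (exp_mart \<theta> (\<rho> T \<omega>) \<omega> * exp (- \<gamma> * B T \<omega>)) \<partial>M)"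
  proof (rule optional_stopping[OF T])
    show "0 \<le> \<rho> T \<omega> \<and> \<rho> T \<omega> \<le> T" for \<omega>
      using T by (intro \<rho>_range) simp
    show "0 \<le> exp (- \<gamma> * B T \<omega>) \<and> exp (- \<gamma> * B T \<omega>) \<le> 1" if "\<omega> \<in> space M" for \<omega>
      using B_nonneg[OF that, of T] \<gamma> by simp
    fix t assume t: "0 \<le> t" "t \<le> T"
    show stop: "{\<omega>\<in>space M. \<rho> T \<omega> \<le> t} \<in> sets (F t)"
      using t by (rule \<rho>_stopping)
    have [measurable]: "B t \<in> borel_measurable (F t)" "{\<omega>\<in>space M. \<rho> T \<omega> \<le> t} \<in> sets (F t)"
      using t stop by (auto intro: B_adapted)
    \<comment> \<open>On \<open>\<rho> T \<le> t\<close> both \<open>B T\<close> and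
      \<open>B t\<close> equal \<open>B (\<rho> T)\<close>, so a quantity from time \<open>T\<close>
      is replaced by one known at \<open>t\<close>.\<close>
    have "(\<lambda>\<omega>. exp (- \<gamma> * B T \<omega>) * indicator {\<omega>\<in>space M. \<rho> T \<omega> \<le> t} \<omega>) =
        (\<lambda>\<omega>. exp (- \<gamma> * B t \<omega>) * indicator {\<omega>\<in>space M. \<rho> T \<omega> \<le> t} \<omega>)"
      using B_T B_after_\<rho>[OF _ t(2)] by (auto simp: indicator_def fun_eq_iff)
    also have "\<dots> \<in> borel_measurable (F t)"
      by measurable
    finally show "(\<lambda>\<omega>. exp (- \<gamma> * B T \<omega>) * indicator {\<omega>\<in>space M. \<rho> T \<omega> \<le> t} \<omega>) \<in> borel_measurable (F t)" .
  qed
  then show ?thesis by (simp only: B_T)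
qed

lemma exp_surplus_\<rho>:
  assumes \<omega>: "\<omega> \<in> space M" and T: "0 \<le> T" and \<gamma>: "(\<gamma> * \<sigma>)\<^sup>2 / 2 = \<gamma> * (\<mu> - cbar) + r"
  shows "exp (- \<gamma> * x) * (exp_mart (\<gamma> * \<sigma>) (\<rho> T \<omega>) \<omega> * exp (- \<gamma> * B (\<rho> T \<omega>) \<omega>)) =
    exp (- r * \<rho> T \<omega> - \<gamma> * X (\<rho> T \<omega>) \<omega>)"
  using \<rho>_range[OF T, of \<omega>] by (intro exp_surplus \<omega> \<rho>_le_\<tau> \<gamma>) simp

text \<open>This serves the constant strategy. If ruin comes by time \<open>T\<close>, the surplus
  at \<open>\<rho>\<close> is 0 and \<open>exp(-r \<rho>)\<close> is itself the stopped expression;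
  otherwise it equals \<open>exp(-r T)\<close>. Optional stopping moves the expectation back to
  \<open>T\<close>, where \<open>exp(-\<gamma> B) \<le> 1\<close> leaves a martingale of mean
  1.\<close>

lemma nn_integral_exp_\<rho>_le:
  assumes \<gamma>: "0 \<le> \<gamma>" "(\<gamma> * \<sigma>)\<^sup>2 / 2 = \<gamma> * (\<mu> - cbar) + r" and T: "0 < T"
  shows "(\<integral>\<^sup>+\<omega>. ennreal (exp (- r * \<rho> T \<omega>)) \<partial>M) \<le> ennreal (exp (- \<gamma> * x) + exp (- r * T))"
proof -
  let ?Z = "exp_mart (\<gamma> * \<sigma>)"
  have "(\<integral>\<^sup>+\<omega>. ennreal (?Z (\<rho> T \<omega>) \<omega> * exp (- \<gamma> * B (\<rho> T \<omega>) \<omega>)) \<partial>M) =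
      (\<integral>\<^sup>+\<omega>. ennreal (?Z T \<omega> * exp (- \<gamma> * B T \<omega>)) \<partial>M)"
    by (rule stopped_exp_B[OF \<gamma>(1) T, symmetric])
  also have "\<dots> \<le> (\<integral>\<^sup>+\<omega>. ennreal (?Z T \<omega>) \<partial>M)"
  proof (intro nn_integral_mono ennreal_leI)
    fix \<omega> assume "\<omega> \<in> space M"
    then have "exp (- \<gamma> * B T \<omega>) \<le> 1"
      using B_nonneg[of \<omega> T] \<gamma>(1) by simp
    then show "?Z T \<omega> * exp (- \<gamma> * B T \<omega>) \<le> ?Z T \<omega>"
      using exp_mart_pos[of "\<gamma> * \<sigma>" T \<omega>] by simp
  qed
  also have "\<dots> = 1"
    using T by (intro nn_integral_exp_mart) simp
  finally have le_1: "(\<integral>\<^sup>+\<omega>. ennreal (?Z (\<rho> T \<omega>) \<omega> * exp (- \<gamma> * B (\<rho> T \<omega>) \<omega>)) \<partial>M) \<le> 1" .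
  have eq: "exp (- \<gamma> * x) * (?Z (\<rho> T \<omega>) \<omega> * exp (- \<gamma> * B (\<rho> T \<omega>) \<omega>)) =
      exp (- r * \<rho> T \<omega> - \<gamma> * X (\<rho> T \<omega>) \<omega>)" if "\<omega> \<in> space M" for \<omega>
    using that T \<gamma>(2) by (intro exp_surplus_\<rho>) auto
  have [measurable]: "(\<lambda>\<omega>. ?Z (\<rho> T \<omega>) \<omega> * exp (- \<gamma> * B (\<rho> T \<omega>) \<omega>)) \<in> borel_measurable M"
    using T by (intro stopped_exp_B_measurable) simp
  have "(\<integral>\<^sup>+\<omega>. ennreal (exp (- r * \<rho> T \<omega>)) \<partial>M) \<le>
      (\<integral>\<^sup>+\<omega>. ennreal (exp (- \<gamma> * x)) * ennreal (?Z (\<rho> T \<omega>) \<omega> * exp (- \<gamma> * B (\<rho> T \<omega>) \<omega>)) + ennreal (exp (- r * T)) \<partial>M)"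
  proof (intro nn_integral_mono)
    fix \<omega> assume \<omega>: "\<omega> \<in> space M"
    have "exp (- r * \<rho> T \<omega>) \<le> exp (- r * \<rho> T \<omega> - \<gamma> * X (\<rho> T \<omega>) \<omega>) + exp (- r * T)"
    proof (cases "ereal T < \<tau> \<omega>")
      case True
      then show ?thesis by (simp add: \<rho>_def)
    next
      case False
      then show ?thesis using X_\<rho>_ruined[OF \<omega>, of T] T by simp
    qed
    then have "ennreal (exp (- r * \<rho> T \<omega>)) \<le> ennreal (exp (- r * \<rho> T \<omega> - \<gamma> * X (\<rho> T \<omega>) \<omega>) + exp (- r * T))"
      by (rule ennreal_leI)
    also have "\<dots> = ennreal (exp (- \<gamma> * x)) * ennreal (?Z (\<rho> T \<omega>) \<omega> * exp (- \<gamma> * B (\<rho> T \<omega>) \<omega>)) + ennreal (exp (- r * T))"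
      unfolding eq[OF \<omega>, symmetric] using exp_mart_pos[of "\<gamma> * \<sigma>" "\<rho> T \<omega>" \<omega>]
      by (simp only: ennreal_plus exp_ge_zero mult_nonneg_nonneg less_imp_le ennreal_mult)
    finally show "ennreal (exp (- r * \<rho> T \<omega>)) \<le> \<dots>" .
  qed
  also have "\<dots> = ennreal (exp (- \<gamma> * x)) * (\<integral>\<^sup>+\<omega>. ennreal (?Z (\<rho> T \<omega>) \<omega> * exp (- \<gamma> * B (\<rho> T \<omega>) \<omega>)) \<partial>M) + ennreal (exp (- r * T))"
    by (subst nn_integral_add) (measurable, subst nn_integral_cmult, measurable, simp add: emeasure_space_1)
  also have "\<dots> \<le> ennreal (exp (- \<gamma> * x)) * 1 + ennreal (exp (- r * T))"
    by (intro add_right_mono mult_left_mono le_1) simp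
  finally show ?thesis by simp
qed

text \<open>Multiplied by \<open>exp(-\<gamma> x)\<close>, each product
  \<open>Z exp(-\<gamma> B)\<close> up to ruin becomes \<open>exp(-r t - \<gamma> X)\<close>, and
  \<open>X \<ge> 0\<close> allows \<open>X\<close> to be dropped.\<close>

lemma exp_initial_surplus_le:
  assumes \<gamma>: "0 \<le> \<gamma>" "(\<gamma> * \<sigma>)\<^sup>2 / 2 = \<gamma> * (\<mu> - cbar) + r" and T: "0 < T"
  shows "ennreal (exp (- \<gamma> * x)) \<le> (\<integral>\<^sup>+\<omega>. ennreal (exp (- r * \<rho> T \<omega>)) \<partial>M) +
    ennreal \<gamma> * (\<integral>\<^sup>+\<omega>. \<integral>\<^sup>+s. ennreal (indicator {0..T} s * (exp (- r * s) * D s \<omega>)) \<partial>lborel \<partial>M)"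
proof -
  let ?Z = "exp_mart (\<gamma> * \<sigma>)"
  define h where "h s \<omega> = D s \<omega> * exp (- \<gamma> * B s \<omega>)" for s \<omega>
  have h_nonneg: "0 \<le> h s \<omega>" if "\<omega> \<in> space M" "0 \<le> s" for s \<omega>
    using D_range[OF that] by (simp add: h_def)
  have h_adapted: "h s \<in> borel_measurable (F s)" if "0 \<le> s" for s
    using D_adapted[of s s] B_adapted[of s s] that unfolding h_def by measurable
  have h_cont: "continuous (at_right s) (\<lambda>s. h s \<omega>)" if "\<omega> \<in> space M" "0 \<le> s" for s \<omega>
    unfolding h_def using that
    by (intro continuous_intros D_right_continuous continuous_on_Ici_imp_at_right[OF B_continuous])
  have Z_T [measurable]: "?Z T \<in> borel_measurable M" using T by simp
  have [measurable]: "B T \<in> borel_measurable M"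
    using B_adapted[of T T] T by (intro measurable_F_imp) auto
  have [measurable]: "(\<lambda>(\<omega>, s). indicator {0..T} s * h s \<omega>) \<in> borel_measurable (M \<Otimes>\<^sub>M lborel)"
    using T by (intro pair_measurable h_adapted h_cont) auto
  have Zh [measurable]: "(\<lambda>(\<omega>, s). indicator {0..T} s * (?Z s \<omega> * h s \<omega>)) \<in> borel_measurable (M \<Otimes>\<^sub>M lborel)"
  proof (intro pair_measurable)
    fix s :: real assume s: "0 \<le> s"
    show "(\<lambda>\<omega>. ?Z s \<omega> * h s \<omega>) \<in> borel_measurable (F s)"
      using s by (intro borel_measurable_times h_adapted exp_mart_adapted) auto
    show "continuous (at_right s) (\<lambda>s. ?Z s \<omega> * h s \<omega>)" if "\<omega> \<in> space M" for \<omega>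
      using s that by (intro continuous_mult h_cont continuous_on_Ici_imp_at_right[OF exp_mart_continuous])
  qed (use T in simp)
  interpret P: pair_sigma_finite M "lborel :: real measure" ..
  have ZTh: "(\<lambda>(\<omega>, s). ennreal (?Z T \<omega>) * ennreal (indicator {0..T} s * h s \<omega>)) \<in> borel_measurable (M \<Otimes>\<^sub>M lborel)"
    by measurable
  have swap: "(\<integral>\<^sup>+\<omega>. \<integral>\<^sup>+s. ennreal (?Z T \<omega>) * ennreal (indicator {0..T} s * h s \<omega>) \<partial>lborel \<partial>M) =
      (\<integral>\<^sup>+\<omega>. \<integral>\<^sup>+s. ennreal (indicator {0..T} s * (?Z s \<omega> * h s \<omega>)) \<partial>lborel \<partial>M)"
  proof -
    have "(\<integral>\<^sup>+\<omega>. ennreal (?Z T \<omega>) * ennreal (indicator {0..T} s * h s \<omega>) \<partial>M) =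
        (\<integral>\<^sup>+\<omega>. ennreal (indicator {0..T} s * (?Z s \<omega> * h s \<omega>)) \<partial>M)" for s
    proof (cases "s \<in> {0..T}")
      case True
      then have "(\<integral>\<^sup>+\<omega>. ennreal (?Z T \<omega>) * ennreal (h s \<omega>) \<partial>M) = (\<integral>\<^sup>+\<omega>. ennreal (?Z s \<omega>) * ennreal (h s \<omega>) \<partial>M)"
        using h_adapted[of s] by (intro exp_mart_martingale) auto
      also have "\<dots> = (\<integral>\<^sup>+\<omega>. ennreal (?Z s \<omega> * h s \<omega>) \<partial>M)"
        using h_nonneg True exp_mart_pos by (intro nn_integral_cong) (simp add: ennreal_mult less_imp_le)
      finally show ?thesis using True by simp
    qed simp
    then show ?thesis
      using P.Fubini'[OF ZTh] P.Fubini'[of "\<lambda>\<omega> s. ennreal (indicator {0..T} s * (?Z s \<omega> * h s \<omega>))"] by simp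
  qed
  have "1 = (\<integral>\<^sup>+\<omega>. ennreal (?Z T \<omega>) \<partial>M)"
    using T by (simp add: nn_integral_exp_mart)
  also have "\<dots> \<le> (\<integral>\<^sup>+\<omega>. ennreal (?Z T \<omega> * exp (- \<gamma> * B T \<omega>)) +
      ennreal \<gamma> * (\<integral>\<^sup>+s. ennreal (?Z T \<omega>) * ennreal (indicator {0..T} s * h s \<omega>) \<partial>lborel) \<partial>M)"
  proof (intro nn_integral_mono)
    fix \<omega> assume \<omega>: "\<omega> \<in> space M"
    have [measurable]: "(\<lambda>s. indicator {0..T} s * h s \<omega>) \<in> borel_measurable lborel"
      using set_borel_measurable_right_continuous[OF h_cont[OF \<omega>], of T] T by (simp add: set_borel_measurable_def)
    have I_nonneg: "0 \<le> (LBINT s:{0..T}. h s \<omega>)"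
      unfolding set_lebesgue_integral_def using h_nonneg[OF \<omega>]
      by (intro integral_nonneg_AE AE_I2) (auto simp: indicator_def)
    have "1 - exp (- \<gamma> * B T \<omega>) \<le> \<gamma> * (LBINT s:{0..T}. h s \<omega>)"
      unfolding B_def h_def using T \<gamma>(1) D_range[OF \<omega>] D_right_continuous[OF \<omega>]
      by (intro one_minus_exp_le_integral[where K=cbar] set_borel_measurable_right_continuous) auto
    then have "?Z T \<omega> * 1 \<le> ?Z T \<omega> * (exp (- \<gamma> * B T \<omega>) + \<gamma> * (LBINT s:{0..T}. h s \<omega>))"
      using exp_mart_pos[of "\<gamma> * \<sigma>" T \<omega>] by (intro mult_left_mono) auto
    then have "ennreal (?Z T \<omega>) \<le> ennreal (?Z T \<omega> * exp (- \<gamma> * B T \<omega>) + \<gamma> * (?Z T \<omega> * (LBINT s:{0..T}. h s \<omega>)))"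
      by (intro ennreal_leI) (simp add: algebra_simps)
    also have "\<dots> = ennreal (?Z T \<omega> * exp (- \<gamma> * B T \<omega>)) + ennreal \<gamma> * (ennreal (?Z T \<omega>) * ennreal (LBINT s:{0..T}. h s \<omega>))"
      using I_nonneg \<gamma>(1) exp_mart_pos[of "\<gamma> * \<sigma>" T \<omega>]
      by (simp only: ennreal_plus ennreal_mult mult_nonneg_nonneg exp_ge_zero less_imp_le)
    also have "ennreal (LBINT s:{0..T}. h s \<omega>) \<le> (\<integral>\<^sup>+s. ennreal (indicator {0..T} s * h s \<omega>) \<partial>lborel)"
      unfolding set_lebesgue_integral_def real_scaleR_def using h_nonneg[OF \<omega>]
      by (intro ennreal_integral_le_nn_integral) (auto simp: indicator_def)
    finally show "ennreal (?Z T \<omega>) \<le> ennreal (?Z T \<omega> * exp (- \<gamma> * B T \<omega>)) +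
      ennreal \<gamma> * (\<integral>\<^sup>+s. ennreal (?Z T \<omega>) * ennreal (indicator {0..T} s * h s \<omega>) \<partial>lborel)"
      by (simp add: nn_integral_cmult add_left_mono mult_left_mono)
  qed
  also have "\<dots> = (\<integral>\<^sup>+\<omega>. ennreal (?Z T \<omega> * exp (- \<gamma> * B T \<omega>)) \<partial>M) +
      ennreal \<gamma> * (\<integral>\<^sup>+\<omega>. \<integral>\<^sup>+s. ennreal (indicator {0..T} s * (?Z s \<omega> * h s \<omega>)) \<partial>lborel \<partial>M)"
    unfolding swap[symmetric]
    by (subst nn_integral_add) (measurable, simp add: nn_integral_cmult)
  finally have "ennreal (exp (- \<gamma> * x)) * 1 \<le> ennreal (exp (- \<gamma> * x)) * \<dots>"
    by (rule mult_left_mono) simp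
  also have "\<dots> = ennreal (exp (- \<gamma> * x)) * (\<integral>\<^sup>+\<omega>. ennreal (?Z (\<rho> T \<omega>) \<omega> * exp (- \<gamma> * B (\<rho> T \<omega>) \<omega>)) \<partial>M) +
      ennreal \<gamma> * (ennreal (exp (- \<gamma> * x)) * (\<integral>\<^sup>+\<omega>. \<integral>\<^sup>+s. ennreal (indicator {0..T} s * (?Z s \<omega> * h s \<omega>)) \<partial>lborel \<partial>M))"
    unfolding stopped_exp_B[OF \<gamma>(1) T] by (simp add: distrib_left mult_ac)
  also have "ennreal (exp (- \<gamma> * x)) * (\<integral>\<^sup>+\<omega>. ennreal (?Z (\<rho> T \<omega>) \<omega> * exp (- \<gamma> * B (\<rho> T \<omega>) \<omega>)) \<partial>M) \<le>
      (\<integral>\<^sup>+\<omega>. ennreal (exp (- r * \<rho> T \<omega>)) \<partial>M)"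
  proof (subst nn_integral_cmult[symmetric])
    show "(\<lambda>\<omega>. ennreal (?Z (\<rho> T \<omega>) \<omega> * exp (- \<gamma> * B (\<rho> T \<omega>) \<omega>))) \<in> borel_measurable M"
      using T by (intro measurable_compose[OF stopped_exp_B_measurable measurable_ennreal]) simp
    show "(\<integral>\<^sup>+\<omega>. ennreal (exp (- \<gamma> * x)) * ennreal (?Z (\<rho> T \<omega>) \<omega> * exp (- \<gamma> * B (\<rho> T \<omega>) \<omega>)) \<partial>M) \<le>
        (\<integral>\<^sup>+\<omega>. ennreal (exp (- r * \<rho> T \<omega>)) \<partial>M)"
    proof (intro nn_integral_mono)
      fix \<omega> assume \<omega>: "\<omega> \<in> space M"
      have "exp (- \<gamma> * x) * (?Z (\<rho> T \<omega>) \<omega> * exp (- \<gamma> * B (\<rho> T \<omega>) \<omega>)) \<le> exp (- r * \<rho> T \<omega>)"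
        using exp_surplus_\<rho>[OF \<omega> _ \<gamma>(2), of T] X_\<rho>_nonneg[OF \<omega>, of T] T \<gamma>(1) by simp
      then show "ennreal (exp (- \<gamma> * x)) * ennreal (?Z (\<rho> T \<omega>) \<omega> * exp (- \<gamma> * B (\<rho> T \<omega>) \<omega>)) \<le> ennreal (exp (- r * \<rho> T \<omega>))"
        by (subst ennreal_mult'[symmetric]) (simp_all only: exp_ge_zero ennreal_leI)
    qed
  qed
  also have "ennreal (exp (- \<gamma> * x)) * (\<integral>\<^sup>+\<omega>. \<integral>\<^sup>+s. ennreal (indicator {0..T} s * (?Z s \<omega> * h s \<omega>)) \<partial>lborel \<partial>M) \<le>
      (\<integral>\<^sup>+\<omega>. \<integral>\<^sup>+s. ennreal (indicator {0..T} s * (exp (- r * s) * D s \<omega>)) \<partial>lborel \<partial>M)"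
  proof -
    have "ennreal (exp (- \<gamma> * x)) * (\<integral>\<^sup>+\<omega>. \<integral>\<^sup>+s. ennreal (indicator {0..T} s * (?Z s \<omega> * h s \<omega>)) \<partial>lborel \<partial>M) =
      (\<integral>\<^sup>+\<omega>. \<integral>\<^sup>+s. ennreal (exp (- \<gamma> * x)) * ennreal (indicator {0..T} s * (?Z s \<omega> * h s \<omega>)) \<partial>lborel \<partial>M)"
      by (subst nn_integral_cmult[symmetric], measurable) (intro nn_integral_cong nn_integral_cmult[symmetric], measurable)
    also have "\<dots> \<le> (\<integral>\<^sup>+\<omega>. \<integral>\<^sup>+s. ennreal (indicator {0..T} s * (exp (- r * s) * D s \<omega>)) \<partial>lborel \<partial>M)"
    proof (intro nn_integral_mono)
      fix \<omega> s assume \<omega>: "\<omega> \<in> space M"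
      show "ennreal (exp (- \<gamma> * x)) * ennreal (indicator {0..T} s * (?Z s \<omega> * h s \<omega>))
          \<le> ennreal (indicator {0..T} s * (exp (- r * s) * D s \<omega>))"
      \<comment> \<open>After ruin the surplus may be negative, but both sides vanish together with
        \<open>D\<close>.\<close>
      proof (cases "s \<in> {0..T} \<and> ereal s < \<tau> \<omega>")
        case True
        then have s: "0 \<le> s" "ereal s \<le> \<tau> \<omega>" "0 \<le> X s \<omega>"
          using less_\<tau>_iff[OF \<omega>, of s] by (auto intro: less_imp_le)
        have "exp (- \<gamma> * x) * (?Z s \<omega> * h s \<omega>) = exp (- r * s - \<gamma> * X s \<omega>) * D s \<omega>"
          using exp_surplus[OF \<omega> s(1,2) \<gamma>(2)] by (simp add: h_def mult_ac)
        also have "\<dots> \<le> exp (- r * s) * D s \<omega>"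
          using D_range[OF \<omega> s(1)] s(3) \<gamma>(1) by (intro mult_right_mono) auto
        finally show ?thesis
          using True by (simp add: ennreal_mult'[symmetric] ennreal_leI)
      qed (auto simp: h_def D_def killed_def)
    qed
    finally show ?thesis .
  qed
  finally show ?thesis
    by (simp add: add_left_mono add_right_mono mult_left_mono)
qed

section \<open>Accounting for dividends paid and withheld\<close>

definition paid :: "real \<Rightarrow> 'a \<Rightarrow> ennreal" where
  "paid T \<omega> = (\<integral>\<^sup>+s. ennreal (indicator {0..T} s * (exp (- r * s) * R s \<omega>)) \<partial>lborel)"

definition withheld :: "real \<Rightarrow> 'a \<Rightarrow> ennreal" where
  "withheld T \<omega> = (\<integral>\<^sup>+s. ennreal (indicator {0..T} s * (exp (- r * s) * D s \<omega>)) \<partial>lborel)"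

lemma discounted_measurable:
  fixes f :: "real \<Rightarrow> 'a \<Rightarrow> real"
  assumes "\<And>s. 0 \<le> s \<Longrightarrow> f s \<in> borel_measurable (F s)"
    and "\<And>\<omega> s. \<omega> \<in> space M \<Longrightarrow> 0 \<le> s \<Longrightarrow> continuous (at_right s) (\<lambda>s. f s \<omega>)" and "0 \<le> T"
  shows "(\<lambda>(\<omega>, s). indicator {0..T} s * (exp (- r * s) * f s \<omega>)) \<in> borel_measurable (M \<Otimes>\<^sub>M lborel)"
  using assms by (intro pair_measurable borel_measurable_times continuous_intros) auto

lemma R_pair_measurable [measurable]:
  "0 \<le> T \<Longrightarrow> (\<lambda>(\<omega>, s). indicator {0..T} s * (exp (- r * s) * R s \<omega>)) \<in> borel_measurable (M \<Otimes>\<^sub>M lborel)"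
  by (intro discounted_measurable R_adapted R_right_continuous) auto

lemma D_pair_measurable [measurable]:
  "0 \<le> T \<Longrightarrow> (\<lambda>(\<omega>, s). indicator {0..T} s * (exp (- r * s) * D s \<omega>)) \<in> borel_measurable (M \<Otimes>\<^sub>M lborel)"
  by (intro discounted_measurable D_adapted D_right_continuous) auto

lemma paid_measurable [measurable]: "0 \<le> T \<Longrightarrow> paid T \<in> borel_measurable M"
  unfolding paid_def using R_pair_measurable[of T] by measurable

lemma withheld_measurable [measurable]: "0 \<le> T \<Longrightarrow> withheld T \<in> borel_measurable M"
  unfolding withheld_def using D_pair_measurable[of T] by measurable

lemma nn_integral_discount_Icc:
  "0 \<le> t \<Longrightarrow> (\<integral>\<^sup>+s. ennreal (cbar * exp (- r * s)) * indicator {0..t} s \<partial>lborel) = ennreal (cbar / r * (1 - exp (- r * t)))"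
  using r_pos cbar_pos
  by (subst nn_integral_FTC_Icc[where F="\<lambda>s. - cbar / r * exp (- r * s)"])
    (auto intro!: derivative_eq_intros simp: field_simps)

lemma discount_tendsto: "((\<lambda>T. k * exp (- r * T)) \<longlongrightarrow> 0) at_top"
proof -
  have "((\<lambda>T. k * exp (- r * T)) \<longlongrightarrow> k * 0) at_top"
    using r_pos
    by (intro tendsto_intros filterlim_compose[OF exp_at_bot] filterlim_tendsto_neg_mult_at_bot[OF tendsto_const] filterlim_ident) auto
  then show ?thesis by simp
qed

lemma nn_integral_discount_atLeast:
  "(\<integral>\<^sup>+s. ennreal (cbar * exp (- r * s)) * indicator {T..} s \<partial>lborel) = ennreal (cbar / r * exp (- r * T))"
  using r_pos cbar_pos discount_tendsto[of "- cbar / r"]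
  by (subst nn_integral_FTC_atLeast[where F="\<lambda>s. - cbar / r * exp (- r * s)" and T=0])
    (auto intro!: derivative_eq_intros simp: field_simps)

text \<open>Before ruin \<open>R + D = cbar\<close>, so the first two terms are the value of paying
  \<open>cbar\<close> until \<open>\<rho>\<close>, and the third is the perpetuity from
  \<open>\<rho>\<close> on. This converts bounds involving \<open>E exp(-r \<rho>)\<close> into
  bounds on dividends.\<close>

lemma paid_plus_withheld:
  assumes \<omega>: "\<omega> \<in> space M" and T: "0 \<le> T"
  shows "paid T \<omega> + withheld T \<omega> + ennreal (cbar / r * exp (- r * \<rho> T \<omega>)) = ennreal (cbar / r)"
proof -
  have [measurable]: "(\<lambda>s. indicator {0..T} s * (exp (- r * s) * R s \<omega>)) \<in> borel_measurable lborel"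
    "(\<lambda>s. indicator {0..T} s * (exp (- r * s) * D s \<omega>)) \<in> borel_measurable lborel"
    using measurable_compose[OF measurable_Pair1'[OF \<omega>] R_pair_measurable[OF T]]
      measurable_compose[OF measurable_Pair1'[OF \<omega>] D_pair_measurable[OF T]] by simp_all
  have "paid T \<omega> + withheld T \<omega> = (\<integral>\<^sup>+s. ennreal (indicator {0..T} s * (exp (- r * s) * R s \<omega>)) +
      ennreal (indicator {0..T} s * (exp (- r * s) * D s \<omega>)) \<partial>lborel)"
    unfolding paid_def withheld_def by (rule nn_integral_add[symmetric]) measurable
  also have "\<dots> = (\<integral>\<^sup>+s. ennreal (cbar * exp (- r * s)) * indicator {0..\<rho> T \<omega>} s \<partial>lborel)"
  proof (rule nn_integral_cong_AE)
    show "AE s in lborel. ennreal (indicator {0..T} s * (exp (- r * s) * R s \<omega>)) +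
        ennreal (indicator {0..T} s * (exp (- r * s) * D s \<omega>)) = ennreal (cbar * exp (- r * s)) * indicator {0..\<rho> T \<omega>} s"
      \<comment> \<open>If \<open>\<rho> = \<tau>\<close>, the killed rates are already 0 at
        \<open>s = \<rho>\<close>, while the closed interval still counts that time.\<close>
      using AE_lborel_singleton[of "\<rho> T \<omega>"]
    proof eventually_elim
      fix s assume s: "s \<noteq> \<rho> T \<omega>"
      have iff: "s \<le> \<rho> T \<omega> \<longleftrightarrow> s \<le> T \<and> ereal s < \<tau> \<omega>"
        using s ereal_\<rho>[of T \<omega>] by (cases "\<tau> \<omega>") (auto simp: min_def split: if_splits)
      show "ennreal (indicator {0..T} s * (exp (- r * s) * R s \<omega>)) +
          ennreal (indicator {0..T} s * (exp (- r * s) * D s \<omega>)) = ennreal (cbar * exp (- r * s)) * indicator {0..\<rho> T \<omega>} s"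
      proof (cases "0 \<le> s \<and> s \<le> T \<and> ereal s < \<tau> \<omega>")
        case True
        then have "0 \<le> R s \<omega>" "0 \<le> D s \<omega>" "R s \<omega> + D s \<omega> = cbar"
          using R_range[OF \<omega>, of s] D_range[OF \<omega>, of s] by (auto simp: R_def D_def killed_def)
        then show ?thesis
          using True iff by (simp add: ennreal_plus[symmetric] mult.commute flip: distrib_left del: ennreal_plus)
      next
        case False
        then have "indicator {0..T} s * (exp (- r * s) * R s \<omega>) = 0" "indicator {0..T} s * (exp (- r * s) * D s \<omega>) = 0"
          by (auto simp: R_def D_def killed_def)
        moreover have "s \<notin> {0..\<rho> T \<omega>}" using False iff by auto
        ultimately show ?thesis by (simp only: indicator_simps) simp
      qed
    qed
  qed
  also have "\<dots> = ennreal (cbar / r * (1 - exp (- r * \<rho> T \<omega>)))"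
    using \<rho>_range[OF T, of \<omega>] by (intro nn_integral_discount_Icc) simp
  finally have eq: "paid T \<omega> + withheld T \<omega> = \<dots>" .
  have "exp (- r * \<rho> T \<omega>) \<le> 1" using \<rho>_range[OF T, of \<omega>] r_pos by simp
  then have "0 \<le> cbar / r * (1 - exp (- r * \<rho> T \<omega>))"
    using r_pos cbar_pos by (intro mult_nonneg_nonneg) auto
  then show ?thesis
    unfolding eq using r_pos cbar_pos
    by (subst ennreal_plus[symmetric]) (auto simp: right_diff_distrib)
qed

lemma integral_paid_plus_withheld:
  assumes T: "0 \<le> T"
  shows "(\<integral>\<^sup>+\<omega>. paid T \<omega> \<partial>M) + (\<integral>\<^sup>+\<omega>. withheld T \<omega> \<partial>M) +
    ennreal (cbar / r) * (\<integral>\<^sup>+\<omega>. ennreal (exp (- r * \<rho> T \<omega>)) \<partial>M) = ennreal (cbar / r)"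
proof -
  have [measurable]: "paid T \<in> borel_measurable M" "withheld T \<in> borel_measurable M" "\<rho> T \<in> borel_measurable M"
    using T by auto
  have "(\<integral>\<^sup>+\<omega>. paid T \<omega> \<partial>M) + (\<integral>\<^sup>+\<omega>. withheld T \<omega> \<partial>M) +
      ennreal (cbar / r) * (\<integral>\<^sup>+\<omega>. ennreal (exp (- r * \<rho> T \<omega>)) \<partial>M) =
      (\<integral>\<^sup>+\<omega>. paid T \<omega> + withheld T \<omega> + ennreal (cbar / r) * ennreal (exp (- r * \<rho> T \<omega>)) \<partial>M)"
    by (simp add: nn_integral_add nn_integral_cmult)
  also have "\<dots> = (\<integral>\<^sup>+\<omega>. ennreal (cbar / r) \<partial>M)"
    using r_pos cbar_pos paid_plus_withheld[OF _ T]
    by (intro nn_integral_cong) (simp only: ennreal_mult[symmetric] exp_ge_zero divide_nonneg_nonneg less_imp_le)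
  finally show ?thesis by (simp add: emeasure_space_1)
qed

section \<open>From a finite horizon to the payoff\<close>

lemma paid_le_payoff:
  "(\<integral>\<^sup>+\<omega>. paid T \<omega> \<partial>M) \<le> payoff M W \<mu> \<sigma> r x C"
  unfolding payoff_def paid_def
  by (intro nn_integral_mono) (auto simp: R_def killed_def indicator_def)

text \<open>Dividends after \<open>T\<close> are worth at most a perpetuity at rate
  \<open>cbar\<close> that starts at \<open>T\<close>.\<close>

lemma payoff_le_paid:
  assumes T: "0 \<le> T"
  shows "payoff M W \<mu> \<sigma> r x C \<le> (\<integral>\<^sup>+\<omega>. paid T \<omega> \<partial>M) + ennreal (cbar / r * exp (- r * T))"
proof -
  have [measurable]: "paid T \<in> borel_measurable M" using T by simp
  have "payoff M W \<mu> \<sigma> r x C \<le> (\<integral>\<^sup>+\<omega>. paid T \<omega> + ennreal (cbar / r * exp (- r * T)) \<partial>M)"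
    unfolding payoff_def
  proof (intro nn_integral_mono)
    fix \<omega> assume \<omega>: "\<omega> \<in> space M"
    have [measurable]: "(\<lambda>s. indicator {0..T} s * (exp (- r * s) * R s \<omega>)) \<in> borel_measurable lborel"
      using measurable_compose[OF measurable_Pair1'[OF \<omega>] R_pair_measurable[OF T]] by simp
    have "(\<integral>\<^sup>+s\<in>{s. 0 \<le> s \<and> ereal s < \<tau> \<omega>}. ennreal (exp (- r * s) * C s \<omega>) \<partial>lborel) \<le>
        (\<integral>\<^sup>+s. ennreal (indicator {0..T} s * (exp (- r * s) * R s \<omega>)) +
          ennreal (cbar * exp (- r * s)) * indicator {T..} s \<partial>lborel)"
    proof (intro nn_integral_mono)
      fix s
      show "ennreal (exp (- r * s) * C s \<omega>) * indicator {s. 0 \<le> s \<and> ereal s < \<tau> \<omega>} s \<le>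
          ennreal (indicator {0..T} s * (exp (- r * s) * R s \<omega>)) + ennreal (cbar * exp (- r * s)) * indicator {T..} s"
      proof (cases "0 \<le> s \<and> ereal s < \<tau> \<omega>")
        case True
        then have "R s \<omega> = C s \<omega>" by (simp add: R_def killed_def)
        moreover have "exp (- r * s) * C s \<omega> \<le> cbar * exp (- r * s)"
          using C_range[OF \<omega>, of s] True by (simp add: less_imp_le)
        ultimately show ?thesis
          using True by (cases "s \<le> T") (auto intro: ennreal_leI add_increasing2)
      qed simp
    qed
    also have "\<dots> = paid T \<omega> + ennreal (cbar / r * exp (- r * T))"
      unfolding paid_def nn_integral_discount_atLeast[symmetric]
      by (rule nn_integral_add) measurable
    finally show "(\<integral>\<^sup>+s\<in>{s. 0 \<le> s \<and> ereal s < \<tau> \<omega>}. ennreal (exp (- r * s) * C s \<omega>) \<partial>lborel) \<le>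
        paid T \<omega> + ennreal (cbar / r * exp (- r * T))" .
  qed
  then show ?thesis
    by (simp add: nn_integral_add emeasure_space_1)
qed

text \<open>\<open>cbar / r * exp(-\<gamma> x)\<close> is at most the expected perpetuity from
  \<open>\<rho>\<close> on plus \<open>\<gamma> cbar / r\<close> times the expected withholding.
  That factor is at most 1, so the accounting identity leaves at most
  \<open>cbar / r * (1 - exp(-\<gamma> x))\<close> for the dividends paid.\<close>

lemma payoff_le:
  assumes \<gamma>: "0 \<le> \<gamma>" "(\<gamma> * \<sigma>)\<^sup>2 / 2 = \<gamma> * (\<mu> - cbar) + r" "\<gamma> * cbar \<le> r"
  shows "payoff M W \<mu> \<sigma> r x C \<le> ennreal (cbar / r * (1 - exp (- \<gamma> * x)))"
proof -
  have "exp (- \<gamma> * x) \<le> 1" using \<gamma>(1) x_nonneg by simp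
  then have v: "0 \<le> cbar / r * (1 - exp (- \<gamma> * x))"
    using r_pos cbar_pos by (intro mult_nonneg_nonneg) auto
  have paid_le: "(\<integral>\<^sup>+\<omega>. paid T \<omega> \<partial>M) \<le> ennreal (cbar / r * (1 - exp (- \<gamma> * x)))" if T: "0 < T" for T
  proof -
    let ?P = "\<integral>\<^sup>+\<omega>. paid T \<omega> \<partial>M" and ?N = "\<integral>\<^sup>+\<omega>. withheld T \<omega> \<partial>M"
    let ?E = "\<integral>\<^sup>+\<omega>. ennreal (exp (- r * \<rho> T \<omega>)) \<partial>M"
    have "ennreal (cbar / r) * ennreal (exp (- \<gamma> * x)) \<le> ennreal (cbar / r) * (?E + ennreal \<gamma> * ?N)"
      using exp_initial_surplus_le[OF \<gamma>(1,2) T] by (intro mult_left_mono) (simp_all add: withheld_def)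
    also have "\<dots> = ennreal (cbar / r) * ?E + ennreal (cbar / r * \<gamma>) * ?N"
      using \<gamma>(1) r_pos cbar_pos by (subst ennreal_mult) (simp_all add: distrib_left mult.assoc)
    also have "\<dots> \<le> ennreal (cbar / r) * ?E + 1 * ?N"
      using \<gamma>(3) r_pos by (intro add_left_mono mult_right_mono) (simp_all add: field_simps)
    finally have "?P + ennreal (cbar / r) * ennreal (exp (- \<gamma> * x)) \<le> ?P + (ennreal (cbar / r) * ?E + 1 * ?N)"
      by (rule add_left_mono)
    also have "\<dots> = ennreal (cbar / r)"
      using integral_paid_plus_withheld[of T] T by (simp add: add_ac)
    also have "\<dots> = ennreal (cbar / r * (1 - exp (- \<gamma> * x)) + cbar / r * exp (- \<gamma> * x))"
      by (simp add: right_diff_distrib)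
    also have "\<dots> = ennreal (cbar / r * (1 - exp (- \<gamma> * x))) + ennreal (cbar / r) * ennreal (exp (- \<gamma> * x))"
      using v r_pos cbar_pos by (simp only: ennreal_plus ennreal_mult exp_ge_zero mult_nonneg_nonneg divide_nonneg_nonneg less_imp_le)
    finally have "?P + ennreal (cbar / r) * ennreal (exp (- \<gamma> * x)) \<le>
        ennreal (cbar / r * (1 - exp (- \<gamma> * x))) + ennreal (cbar / r) * ennreal (exp (- \<gamma> * x))" .
    \<comment> \<open>A summand can be cancelled in \<open>ennreal\<close> only if it is
      finite.\<close>
    moreover have "ennreal (cbar / r) * ennreal (exp (- \<gamma> * x)) \<noteq> \<top>"
      by (simp add: ennreal_mult_eq_top_iff)
    ultimately show ?thesis
      unfolding add.commute[of _ "ennreal (cbar / r) * ennreal (exp (- \<gamma> * x))"] ennreal_add_left_cancel_le by simp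
  qed
  have lim: "((\<lambda>T. ennreal (cbar / r * (1 - exp (- \<gamma> * x)) + cbar / r * exp (- r * T))) \<longlongrightarrow>
      ennreal (cbar / r * (1 - exp (- \<gamma> * x)) + 0)) at_top"
    by (intro tendsto_ennrealI tendsto_add tendsto_const discount_tendsto)
  have "payoff M W \<mu> \<sigma> r x C \<le> ennreal (cbar / r * (1 - exp (- \<gamma> * x)) + cbar / r * exp (- r * T))" if T: "0 < T" for T
  proof -
    have "payoff M W \<mu> \<sigma> r x C \<le> (\<integral>\<^sup>+\<omega>. paid T \<omega> \<partial>M) + ennreal (cbar / r * exp (- r * T))"
      using T by (intro payoff_le_paid) simp
    also have "\<dots> \<le> ennreal (cbar / r * (1 - exp (- \<gamma> * x))) + ennreal (cbar / r * exp (- r * T))"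
      by (intro add_right_mono paid_le T)
    finally show ?thesis
      using v r_pos cbar_pos by (subst ennreal_plus) auto
  qed
  then have "payoff M W \<mu> \<sigma> r x C \<le> ennreal (cbar / r * (1 - exp (- \<gamma> * x)) + 0)"
    by (intro tendsto_lowerbound[OF lim eventually_mono[OF eventually_gt_at_top[of 0]]]) simp_all
  then show ?thesis by simp
qed

text \<open>With nothing withheld, the accounting identity determines the dividends paid from
  \<open>E exp(-r \<rho>)\<close>; the upper bound for the latter leaves an error
  \<open>cbar / r * exp(-r T)\<close>, which vanishes as \<open>T\<close> grows.\<close>

lemma payoff_ge:
  assumes \<gamma>: "0 \<le> \<gamma>" "(\<gamma> * \<sigma>)\<^sup>2 / 2 = \<gamma> * (\<mu> - cbar) + r"
    and C_eq: "\<And>t \<omega>. C t \<omega> = cbar"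
  shows "ennreal (cbar / r * (1 - exp (- \<gamma> * x))) \<le> payoff M W \<mu> \<sigma> r x C"
proof -
  \<comment> \<open>The real difference may be negative, for instance at \<open>x = 0\<close>;
    \<open>ennreal\<close> then truncates it to 0 and the bound is trivial.\<close>
  have bound: "ennreal (cbar / r * (1 - exp (- \<gamma> * x)) - cbar / r * exp (- r * T)) \<le> payoff M W \<mu> \<sigma> r x C" if T: "0 < T" for T
  proof -
    let ?P = "\<integral>\<^sup>+\<omega>. paid T \<omega> \<partial>M"
    let ?E = "\<integral>\<^sup>+\<omega>. ennreal (exp (- r * \<rho> T \<omega>)) \<partial>M"
    have "withheld T \<omega> = 0" for \<omega>
      by (simp add: withheld_def D_def killed_def C_eq)
    then have "ennreal (cbar / r) = ?P + ennreal (cbar / r) * ?E"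
      using integral_paid_plus_withheld[of T] T by simp
    also have "\<dots> \<le> ?P + ennreal (cbar / r) * ennreal (exp (- \<gamma> * x) + exp (- r * T))"
      by (intro add_left_mono mult_left_mono nn_integral_exp_\<rho>_le \<gamma> T) simp
    also have "\<dots> = ?P + ennreal (cbar / r * (exp (- \<gamma> * x) + exp (- r * T)))"
      using r_pos cbar_pos
      by (simp only: ennreal_mult add_nonneg_nonneg exp_ge_zero divide_nonneg_nonneg less_imp_le)
    finally have "ennreal (cbar / r) \<le> ?P + ennreal (cbar / r * (exp (- \<gamma> * x) + exp (- r * T)))" .
    then have "ennreal (cbar / r) - ennreal (cbar / r * (exp (- \<gamma> * x) + exp (- r * T))) \<le> ?P"
      by (simp add: ennreal_minus_le_iff add.commute)
    moreover have "ennreal (cbar / r) - ennreal (cbar / r * (exp (- \<gamma> * x) + exp (- r * T))) =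
        ennreal (cbar / r * (1 - exp (- \<gamma> * x)) - cbar / r * exp (- r * T))"
      using r_pos cbar_pos by (subst ennreal_minus) (auto simp: algebra_simps)
    ultimately show ?thesis
      using paid_le_payoff[of T] by simp
  qed
  have lim: "((\<lambda>T. ennreal (cbar / r * (1 - exp (- \<gamma> * x)) - cbar / r * exp (- r * T))) \<longlongrightarrow>
      ennreal (cbar / r * (1 - exp (- \<gamma> * x)) - 0)) at_top"
    by (intro tendsto_ennrealI tendsto_diff tendsto_const discount_tendsto)
  have "ennreal (cbar / r * (1 - exp (- \<gamma> * x)) - 0) \<le> payoff M W \<mu> \<sigma> r x C"
    by (rule tendsto_upperbound[OF lim eventually_mono[OF eventually_gt_at_top[of 0] bound]]) simp_all
  then show ?thesis by simp
qed

end

section \<open>Optimality of the maximal dividend rate\<close>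

text \<open>Nonnegativity of \<open>C\<close> before ruin comes from the lower bound in
  admissibility: the running maximum is at least \<open>c \<ge> 0\<close>, whatever the supremum
  is.\<close>

lemma admissible_imp_dividend_control:
  assumes "is_std_BM M W" "0 < r" "0 < cbar" "0 \<le> x" "0 \<le> b" "0 \<le> c"
    and C: "C \<in> admissible M W \<mu> \<sigma> cbar b x c"
  shows "dividend_control M W \<mu> \<sigma> r cbar x C"
proof
  show "0 \<le> C t \<omega> \<and> C t \<omega> \<le> cbar"
    if "\<omega> \<in> space M" "0 \<le> t" "ereal t \<le> ruin_time (surplus x \<mu> \<sigma> W C) \<omega>" for \<omega> t
  proof -
    have "b * running_max c C t \<omega> \<le> C t \<omega>" "C t \<omega> \<le> cbar"
      using C that by (auto simp: admissible_def)
    moreover have "0 \<le> b * running_max c C t \<omega>"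
      using assms by (auto simp: running_max_def intro!: mult_nonneg_nonneg max.coboundedI1)
    ultimately show ?thesis by simp
  qed
qed (use assms in \<open>auto simp: admissible_def\<close>)

text \<open>Since \<open>c \<le> cbar\<close>, the running maximum of the constant path is
  \<open>cbar\<close>, and the lower bound reads \<open>b * cbar \<le> cbar\<close>.\<close>

lemma const_admissible:
  assumes "0 \<le> b" "b \<le> 1" "c \<le> cbar" "0 \<le> cbar"
  shows "(\<lambda>t \<omega>. cbar) \<in> admissible M W \<mu> \<sigma> cbar b x c"
proof -
  have "b * cbar \<le> cbar" using assms mult_right_mono[of b 1 cbar] by simp
  then show ?thesis
    using assms by (auto simp: admissible_def cadlag_def running_max_def image_constant_conv)
qed

theorem theorem4p1:
  fixes M :: "'a measure" and W :: "real \<Rightarrow> 'a \<Rightarrow> real"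
    and \<mu> \<sigma> r cbar b :: real
  assumes BM: "is_std_BM M W"
    and \<sigma>_pos: "\<sigma> > 0" and r_pos: "r > 0"
    and cbar: "0 < cbar" "cbar \<le> \<mu>"
    and b: "0 \<le> b" "b \<le> 1"
    and cond: "2 * \<mu> * cbar \<le> \<sigma>\<^sup>2 * r"
  defines "\<gamma> \<equiv> (sqrt ((\<mu> - cbar)\<^sup>2 + 2 * \<sigma>\<^sup>2 * r) + (\<mu> - cbar)) / \<sigma>\<^sup>2"
  shows "\<forall>x c. 0 \<le> x \<and> 0 \<le> c \<and> c \<le> cbar \<longrightarrow>
           value_fun M W \<mu> \<sigma> r cbar b x c = ennreal (cbar / r * (1 - exp (- \<gamma> * x))) \<and>
           (\<lambda>t \<omega>. cbar) \<in> admissible M W \<mu> \<sigma> cbar b x c \<and>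
           payoff M W \<mu> \<sigma> r x (\<lambda>t \<omega>. cbar) = value_fun M W \<mu> \<sigma> r cbar b x c"
proof (intro allI impI)
  fix x c :: real assume xc: "0 \<le> x \<and> 0 \<le> c \<and> c \<le> cbar"
  define s where "s = sqrt ((\<mu> - cbar)\<^sup>2 + 2 * \<sigma>\<^sup>2 * r)"
  have s: "s\<^sup>2 = (\<mu> - cbar)\<^sup>2 + 2 * \<sigma>\<^sup>2 * r" "0 \<le> s"
    using r_pos by (simp_all add: s_def)
  have \<gamma>_eq: "\<gamma> * \<sigma>\<^sup>2 = s + (\<mu> - cbar)"
    using \<sigma>_pos by (simp add: \<gamma>_def s_def)
  have \<gamma>_nonneg: "0 \<le> \<gamma>"
    unfolding \<gamma>_def s_def[symmetric] using s cbar by (intro divide_nonneg_nonneg) auto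
  \<comment> \<open>Isolating the square root before squaring removes it; then
    \<open>(\<mu> - cbar)^2\<close> and a common factor \<open>\<sigma>^2\<close> cancel.\<close>
  have quad: "(\<gamma> * \<sigma>)\<^sup>2 / 2 = \<gamma> * (\<mu> - cbar) + r"
  proof -
    have "(\<gamma> * \<sigma>\<^sup>2 - (\<mu> - cbar))\<^sup>2 = (\<mu> - cbar)\<^sup>2 + 2 * \<sigma>\<^sup>2 * r"
      using \<gamma>_eq s(1) by simp
    then have "\<sigma>\<^sup>2 * ((\<gamma> * \<sigma>)\<^sup>2 / 2) = \<sigma>\<^sup>2 * (\<gamma> * (\<mu> - cbar) + r)"
      by (simp add: power2_eq_square algebra_simps)
    then show ?thesis using \<sigma>_pos by simp
  qed
  have \<gamma>_le: "\<gamma> * cbar \<le> r"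
  proof (rule ccontr)
    assume "\<not> \<gamma> * cbar \<le> r"
    then have less: "r < \<gamma> * cbar" by simp
    \<comment> \<open>Multiplying the hypothesis by \<open>\<gamma>\<close> and using
      \<open>r < \<gamma> * cbar\<close> produces \<open>\<sigma>^2 \<gamma>^2\<close>, which the
      quadratic equation eliminates; what remains is \<open>\<gamma> * cbar < r\<close>, a
      contradiction.\<close>
    have "2 * \<mu> * cbar * \<gamma> \<le> \<sigma>\<^sup>2 * r * \<gamma>"
      using cond \<gamma>_nonneg by (rule mult_right_mono)
    also have "\<sigma>\<^sup>2 * r * \<gamma> < \<sigma>\<^sup>2 * (\<gamma> * cbar) * \<gamma>"
    proof (intro mult_strict_right_mono mult_strict_left_mono less)
      show "0 < \<gamma>"
        using less r_pos \<gamma>_nonneg by (cases "\<gamma> = 0") auto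
    qed (use \<sigma>_pos in simp)
    also have "\<dots> = 2 * cbar * (\<gamma> * (\<mu> - cbar) + r)"
      unfolding quad[symmetric] by (simp add: power2_eq_square)
    finally have "cbar * (\<gamma> * cbar) < cbar * r"
      by (simp add: algebra_simps)
    with less cbar show False by simp
  qed
  have adm: "(\<lambda>t \<omega>. cbar) \<in> admissible M W \<mu> \<sigma> cbar b x c"
    using b cbar xc by (intro const_admissible) auto
  have upper: "payoff M W \<mu> \<sigma> r x C \<le> ennreal (cbar / r * (1 - exp (- \<gamma> * x)))"
    if "C \<in> admissible M W \<mu> \<sigma> cbar b x c" for C
  proof -
    interpret dividend_control M W \<mu> \<sigma> r cbar x C
      using that BM r_pos cbar b xc by (intro admissible_imp_dividend_control) auto
    show ?thesis using \<gamma>_nonneg quad \<gamma>_le by (rule payoff_le)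
  qed
  interpret const: dividend_control M W \<mu> \<sigma> r cbar x "\<lambda>t \<omega>. cbar"
    using adm BM r_pos cbar b xc by (intro admissible_imp_dividend_control) auto
  have payoff_const: "payoff M W \<mu> \<sigma> r x (\<lambda>t \<omega>. cbar) = ennreal (cbar / r * (1 - exp (- \<gamma> * x)))"
    using upper[OF adm] const.payoff_ge[OF \<gamma>_nonneg quad] by (intro antisym) simp_all
  have "value_fun M W \<mu> \<sigma> r cbar b x c = ennreal (cbar / r * (1 - exp (- \<gamma> * x)))"
    unfolding value_fun_def
  proof (rule antisym)
    show "(SUP C\<in>admissible M W \<mu> \<sigma> cbar b x c. payoff M W \<mu> \<sigma> r x C) \<le> ennreal (cbar / r * (1 - exp (- \<gamma> * x)))"
      by (intro SUP_least upper)
    show "ennreal (cbar / r * (1 - exp (- \<gamma> * x))) \<le> (SUP C\<in>admissible M W \<mu> \<sigma> cbar b x c. payoff M W \<mu> \<sigma> r x C)"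
      using SUP_upper[OF adm, of "payoff M W \<mu> \<sigma> r x"] by (simp add: payoff_const)
  qed
  then show "value_fun M W \<mu> \<sigma> r cbar b x c = ennreal (cbar / r * (1 - exp (- \<gamma> * x))) \<and>
      (\<lambda>t \<omega>. cbar) \<in> admissible M W \<mu> \<sigma> cbar b x c \<and>
      payoff M W \<mu> \<sigma> r x (\<lambda>t \<omega>. cbar) = value_fun M W \<mu> \<sigma> r cbar b x c"
    using adm payoff_const by simp
qed

end
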